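(* Consider the over-the-air average consensus protocol described in the context, with step sizes $\alpha(k)>0$ satisfying (i) $\sum_{k=0}^\infty \alpha(k)=\infty$ and $\sum_{k=0}^\infty \alpha^2(k)<\infty$, and (ii) $1-\alpha(k)\sum_{j\in\mathcal{V}}\bar a_{ij}>0$ for all $i\in\mathcal{V}$, $k\ge 0$. Then the system achieves almost sure consensus: there exists a random variable $x^*$ such that $\lim_{k\to\infty}x_i(k)=x^*$ almost surely for every $i\in\mathcal{V}$.
   Context: Agents $\mathcal{V}=\{1,\dots,N\}$ communicate over a connected undirected graph $\mathcal{G}=(\mathcal{V},\mathcal{E})$ without self-loops; $\widetilde{\mathcal{N}}_i=\{j:(i,j)\in\mathcal{E}\}$. Each agent has a deterministic initial state $x_i(0)\in[0,x_{\max}]$. Fix $\rho>0$ and $u\in\mathbb{C}$ with $|u|=1$. The following random variables are all mutually independent: for each $i$ and $k\ge0$, $\gamma_i(k)\in\{0,1\}$ with $\mathbb{P}(\gamma_i(k)=1)=p_i\in(0,1)$; for each ordered pair $(i,j)$ and $k\ge0$, $h_{ij}(k)\sim\mathcal{CN}(0,\Lambda_{ij})$ with $\Lambda_{ij}=\Lambda_{ji}>0$; for each $i$ and $k\ge0$, $n_i(k)\sim\mathcal{CN}(0,\sigma_i^2)$. Let $\Gamma_{ij}(k)=\gamma_i(k)(1-\gamma_j(k))+\gamma_j(k)(1-\gamma_i(k))$. Agent $i$ receives $y_i(k)=\sum_{j\in\widetilde{\mathcal{N}}_i}\Gamma_{ij}(k)h_{ij}(k)\sqrt{\rho x_j(k)}\,u+n_i(k)$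 (the model treats the states as nonnegative so that the square root is real). Define $\bar a_{ij}=\rho\big(p_i(1-p_j)+p_j(1-p_i)\big)\Lambda_{ij}$ for $j\in\widetilde{\mathcal{N}}_i$ and $\bar a_{ij}=0$ otherwise. The protocol is $$x_i(k+1)=\Big(1-\alpha(k)\sum_{j\in\mathcal{V}}\bar a_{ij}\Big)x_i(k)+\alpha(k)\big(|y_i(k)|^2-\sigma_i^2\big).$$ *)

theory Defs
  imports "HOL-Probability.Probability"
begin

text \<open>Density of the circularly-symmetric complex Gaussian CN(0,s), s > 0,
  with respect to Lebesgue measure on the complex plane (= R^2).\<close>
definition cn_density :: "real \<Rightarrow> complex \<Rightarrow> real" where
  "cn_density s z = exp (- (cmod z)\<^sup>2 / s) / (pi * s)"

datatype 'v oac_idx = Gam 'v nat | Chan 'v 'v nat | Noi 'v nat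

text \<open>All primitive random variables embedded as complex-valued random variables
  (the Bernoulli variables gamma are embedded as 0/1), so that mutual independence
  can be stated as independence of a single family.\<close>
fun oac_family ::
  "('v \<Rightarrow> nat \<Rightarrow> 'm \<Rightarrow> bool) \<Rightarrow> ('v \<Rightarrow> 'v \<Rightarrow> nat \<Rightarrow> 'm \<Rightarrow> complex)
   \<Rightarrow> ('v \<Rightarrow> nat \<Rightarrow> 'm \<Rightarrow> complex) \<Rightarrow> 'v oac_idx \<Rightarrow> 'm \<Rightarrow> complex" where
  "oac_family \<gamma> h n (Gam i k) = (\<lambda>\<omega>. if \<gamma> i k \<omega> then 1 else 0)"
| "oac_family \<gamma> h n (Chan i j k) = h i j k"
| "oac_family \<gamma> h n (Noi i k) = n i k"

definition abar ::
  "real \<Rightarrow> ('v \<Rightarrow> 'v \<Rightarrow> bool) \<Rightarrow> ('v \<Rightarrow> real) \<Rightarrow> ('v \<Rightarrow> 'v \<Rightarrow> real) \<Rightarrow> 'v \<Rightarrow> 'v \<Rightarrow> real" where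
  "abar \<rho> E p \<Lambda> i j =
     (if E i j then \<rho> * (p i * (1 - p j) + p j * (1 - p i)) * \<Lambda> i j else 0)"

definition Gam_ij :: "('v \<Rightarrow> nat \<Rightarrow> 'm \<Rightarrow> bool) \<Rightarrow> 'v \<Rightarrow> 'v \<Rightarrow> nat \<Rightarrow> 'm \<Rightarrow> real" where
  "Gam_ij \<gamma> i j k \<omega> =
     (if \<gamma> i k \<omega> \<noteq> \<gamma> j k \<omega> then 1 else 0)"

definition rx_signal ::
  "real \<Rightarrow> complex \<Rightarrow> ('v::finite \<Rightarrow> 'v \<Rightarrow> bool) \<Rightarrow> ('v \<Rightarrow> nat \<Rightarrow> 'm \<Rightarrow> bool)
   \<Rightarrow> ('v \<Rightarrow> 'v \<Rightarrow> nat \<Rightarrow> 'm \<Rightarrow> complex) \<Rightarrow> ('v \<Rightarrow> nat \<Rightarrow> 'm \<Rightarrow> complex)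
   \<Rightarrow> ('v \<Rightarrow> 'm \<Rightarrow> real) \<Rightarrow> nat \<Rightarrow> 'v \<Rightarrow> 'm \<Rightarrow> complex" where
  "rx_signal \<rho> u E \<gamma> h n xk k i \<omega> =
     (\<Sum>j\<in>{j. E i j}. complex_of_real (Gam_ij \<gamma> i j k \<omega>) * h i j k \<omega>
          * complex_of_real (sqrt (\<rho> * xk j \<omega>)) * u) + n i k \<omega>"

primrec oac_state ::
  "real \<Rightarrow> complex \<Rightarrow> ('v::finite \<Rightarrow> 'v \<Rightarrow> bool) \<Rightarrow> ('v \<Rightarrow> real) \<Rightarrow> ('v \<Rightarrow> 'v \<Rightarrow> real)
   \<Rightarrow> ('v \<Rightarrow> real) \<Rightarrow> (nat \<Rightarrow> real) \<Rightarrow> ('v \<Rightarrow> real)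
   \<Rightarrow> ('v \<Rightarrow> nat \<Rightarrow> 'm \<Rightarrow> bool) \<Rightarrow> ('v \<Rightarrow> 'v \<Rightarrow> nat \<Rightarrow> 'm \<Rightarrow> complex)
   \<Rightarrow> ('v \<Rightarrow> nat \<Rightarrow> 'm \<Rightarrow> complex) \<Rightarrow> nat \<Rightarrow> 'v \<Rightarrow> 'm \<Rightarrow> real" where
  "oac_state \<rho> u E p \<Lambda> \<sigma> \<alpha> x0 \<gamma> h n 0 = (\<lambda>i \<omega>. x0 i)"
| "oac_state \<rho> u E p \<Lambda> \<sigma> \<alpha> x0 \<gamma> h n (Suc k) =
     (\<lambda>i \<omega>. (1 - \<alpha> k * (\<Sum>j\<in>UNIV. abar \<rho> E p \<Lambda> i j))
              * oac_state \<rho> u E p \<Lambda> \<sigma> \<alpha> x0 \<gamma> h n k i \<omega>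
            + \<alpha> k * ((cmod (rx_signal \<rho> u E \<gamma> h n
                         (oac_state \<rho> u E p \<Lambda> \<sigma> \<alpha> x0 \<gamma> h n k) k i \<omega>))\<^sup>2
                       - (\<sigma> i)\<^sup>2))"

end

theory Submission
  imports Defs
begin

text \<open>Write the protocol as \<open>x(k+1) = x(k) + \<alpha>(k) b(x(k)) + \<alpha>(k) \<xi>(k)\<close> with \<open>\<xi>\<close> a martingale difference.
  The received power exceeds its mean by a quadratic form in the fresh Gaussian and Bernoulli
  variables whose coefficients are products of square roots of past states, so \<open>E \<xi>(k)\<^sup>2\<close> is at most
  linear in \<open>E |x(k)|\<^sup>2\<close>. The noise can make states negative; as \<open>sqrt\<close> is odd, the mean drift is
  \<open>b\<^sub>i(x) = \<Sum>\<^sub>j a\<^sub>i\<^sub>j (|x\<^sub>j| - x\<^sub>i)\<close>, the Laplacian drift plus the nonnegative excess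
  \<open>\<Sum>\<^sub>j a\<^sub>i\<^sub>j (|x\<^sub>j| - x\<^sub>j)\<close>. Still \<open>x \<bullet> b(x) \<le> 0\<close>, so \<open>E |x(k)|\<^sup>2\<close> stays bounded. Then
  \<open>\<Sum> \<alpha>(k) \<xi>(k)\<close> converges almost surely as an \<open>L\<^sup>2\<close>-bounded martingale, and so does the weighted
  series of excesses, because the expected sum of the states grows exactly by the expected excess.
  Hence almost every path is a Laplacian iteration with a convergent perturbation series, and the
  spectral gap of the connected graph forces consensus.\<close>

section \<open>Perturbed Laplacian iterations\<close>

text \<open>The obstacle is the excess. Dissipation of the energy controls only squares of
  differences between states and absolute states, while the excess enters linearly with weights
  \<alpha>(k) whose sum diverges, so an energy estimate alone does not make its series converge. The
  sum of the states does: symmetric weights cancel the Laplacian part, the noise has mean zero, and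
  a term of one sign remains whose expectations telescope.

  The martingale property takes a weak form: \<xi>(k) is orthogonal to every square-integrable
  function of the variables before time k. This follows from independence and the product rule,
  within unconditional expectations. The states enter \<xi>(k) through products of at most two
  square roots; squaring such a product gives at most a quadratic in the states. Hence the second
  moment of \<xi>(k) closes against the energy, with fourth moments of the Gaussian variables as
  constants, and the expected energy can grow only at order
  \<open>(\<alpha> k)\<^sup>2\<close>.\<close>

lemma contraction_with_vanishing_input_tendsto_0:
  fixes v a \<delta> :: "nat \<Rightarrow> real"
  assumes v: "\<And>k. 0 \<le> v k" and a: "\<And>k. 0 < a k" and c: "0 < c"
    and div: "\<not> summable a" and a0: "a \<longlonglongrightarrow> 0" and \<delta>: "\<delta> \<longlonglongrightarrow> 0"
    and step: "\<forall>\<^sub>F k in sequentially. v (Suc k) \<le> (1 - c * a k) * v k + a k * \<delta> k"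
  shows "v \<longlonglongrightarrow> 0"
proof (rule order_tendstoI)
  fix e :: real assume "e < 0" then show "\<forall>\<^sub>F k in sequentially. e < v k"
    by (intro always_eventually allI) (rule less_le_trans[OF _ v])
next
  fix e0 :: real assume e0: "0 < e0"
  \<comment> \<open>Half the target: \<open>v - e\<close> is pushed below \<open>e\<close>, hence
    \<open>v\<close> below \<open>e0\<close>.\<close>
  define e where "e = e0 / 2"
  have e: "0 < e" using e0 by (simp add: e_def)
  have "\<forall>\<^sub>F k in sequentially. \<delta> k < c * e"
    using order_tendstoD(2)[OF \<delta>, of "c * e"] c e by simp
  moreover have "\<forall>\<^sub>F k in sequentially. a k < 1 / c"
    using order_tendstoD(2)[OF a0, of "1 / c"] c by simp
  ultimately have "\<forall>\<^sub>F k in sequentially. \<delta> k < c * e \<and> a k < 1 / c \<and>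
      v (Suc k) \<le> (1 - c * a k) * v k + a k * \<delta> k"
    using step by eventually_elim auto
  then obtain K where K: "\<And>k. k \<ge> K \<Longrightarrow> \<delta> k < c * e" "\<And>k. k \<ge> K \<Longrightarrow> a k < 1 / c"
    "\<And>k. k \<ge> K \<Longrightarrow> v (Suc k) \<le> (1 - c * a k) * v k + a k * \<delta> k"
    unfolding eventually_sequentially by blast
  \<comment> \<open>Once \<open>\<delta> k < c * e\<close>, the input is less than what the
    contraction removes at level \<open>e\<close>, so \<open>v - e\<close> satisfies a recursion
    without input.\<close>
  have step': "v (Suc k) - e \<le> (1 - c * a k) * (v k - e)" if "k \<ge> K" for k
  proof -
    have "a k * \<delta> k \<le> a k * (c * e)"
      using K(1)[OF that] a[of k] by (intro mult_left_mono) auto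
    with K(3)[OF that] show ?thesis by (simp add: algebra_simps)
  qed
  \<comment> \<open>The product of the factors \<open>1 - c * a\<close> is dominated by an
    exponential of partial sums. The absolute value keeps the right side nonnegative even if
    \<open>v K < e\<close>, so each factor may be enlarged.\<close>
  have bound: "v (K + m) - e \<le> exp (- c * (\<Sum>i<m. a (K + i))) * \<bar>v K - e\<bar>" for m
  proof (induction m)
    case (Suc m)
    let ?g = "1 - c * a (K + m)"
    have g: "0 \<le> ?g" using K(2)[of "K + m"] c by (simp add: field_simps)
    have "v (K + Suc m) - e \<le> ?g * (v (K + m) - e)" using step'[of "K + m"] by simp
    also have "\<dots> \<le> ?g * (exp (- c * (\<Sum>i<m. a (K + i))) * \<bar>v K - e\<bar>)"
      by (rule mult_left_mono[OF Suc g])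
    also have "\<dots> \<le> exp (- c * a (K + m)) * (exp (- c * (\<Sum>i<m. a (K + i))) * \<bar>v K - e\<bar>)"
      using exp_ge_add_one_self[of "- c * a (K + m)"] by (intro mult_right_mono) auto
    also have "\<dots> = exp (- c * (\<Sum>i<Suc m. a (K + i))) * \<bar>v K - e\<bar>"
      by (simp add: exp_add[symmetric] algebra_simps)
    finally show ?case .
  qed simp
  have "\<not> summable (\<lambda>i. a (K + i))"
    using div summable_iff_shift[of a K] by (simp add: add.commute)
  then have "filterlim (\<lambda>m. \<Sum>i<m. a (K + i)) at_top sequentially"
  proof (rule contrapos_np)
    assume nl: "\<not> filterlim (\<lambda>m. \<Sum>i<m. a (K + i)) at_top sequentially"
    have mono: "mono (\<lambda>m. \<Sum>i<m. a (K + i))"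
      using a by (intro monoI sum_mono2) (auto intro: less_imp_le)
    from nl obtain B where nB: "\<not> eventually (\<lambda>m. B \<le> (\<Sum>i<m. a (K + i))) sequentially"
      unfolding filterlim_at_top by blast
    have B: "(\<Sum>i<m. a (K + i)) < B" for m
    proof (rule ccontr)
      assume "\<not> (\<Sum>i<m. a (K + i)) < B"
      then have "\<forall>n\<ge>m. B \<le> (\<Sum>i<n. a (K + i))"
        using monoD[OF mono, of m] by force
      with nB show False unfolding eventually_sequentially by blast
    qed
    show "summable (\<lambda>i. a (K + i))"
      by (rule summableI_nonneg_bounded[where x = B]) (use B a in \<open>auto intro: less_imp_le\<close>)
  qed
  from filterlim_tendsto_neg_mult_at_bot[OF tendsto_const _ this, of "- c"] c
  have "filterlim (\<lambda>m. - c * (\<Sum>i<m. a (K + i))) at_bot sequentially" by simp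
  then have "(\<lambda>m. exp (- c * (\<Sum>i<m. a (K + i)))) \<longlonglongrightarrow> 0"
    by (rule filterlim_compose[OF exp_at_bot])
  then have "(\<lambda>m. exp (- c * (\<Sum>i<m. a (K + i))) * \<bar>v K - e\<bar>) \<longlonglongrightarrow> 0"
    by (rule tendsto_mult_left_zero)
  then have "\<forall>\<^sub>F m in sequentially. exp (- c * (\<Sum>i<m. a (K + i))) * \<bar>v K - e\<bar> < e"
    by (rule order_tendstoD(2)) (rule e)
  then have "\<forall>\<^sub>F m in sequentially. v (m + K) < e0"
  proof eventually_elim
    case (elim m) with bound[of m] show ?case by (simp add: e_def add.commute)
  qed
  then show "\<forall>\<^sub>F k in sequentially. v k < e0"
    by (rule eventually_sequentially_seg[THEN iffD1])
qed

section \<open>Weighted graph Laplacian, Dirichlet form and spectral gap\<close>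

definition lap :: "('v::finite \<Rightarrow> 'v \<Rightarrow> real) \<Rightarrow> ('v \<Rightarrow> real) \<Rightarrow> 'v \<Rightarrow> real" where
  "lap A z i = (\<Sum>j\<in>UNIV. A i j * (z i - z j))"

text \<open>The sum runs over ordered pairs, so every undirected edge counts twice; this is the
  origin of the factor 1/2 in \<open>sum_mult_lap\<close>.\<close>

definition dirichlet :: "('v::finite \<Rightarrow> 'v \<Rightarrow> real) \<Rightarrow> ('v \<Rightarrow> real) \<Rightarrow> real" where
  "dirichlet A z = (\<Sum>i\<in>UNIV. \<Sum>j\<in>UNIV. A i j * (z i - z j)\<^sup>2)"

lemma lap_add: "lap A (\<lambda>i. y i + z i) i = lap A y i + lap A z i"
  by (simp add: lap_def sum.distrib[symmetric] algebra_simps)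

lemma lap_diff_const: "lap A (\<lambda>i. z i - c) = lap A z"
  by (simp add: lap_def fun_eq_iff)

lemma sum_lap_eq_0:
  assumes "\<And>i j. A i j = A j i"
  shows "(\<Sum>i\<in>UNIV. lap A z i) = 0"
proof -
  have "(\<Sum>i\<in>UNIV. lap A z i) = (\<Sum>i\<in>UNIV. \<Sum>j\<in>UNIV. A i j * z i) - (\<Sum>i\<in>UNIV. \<Sum>j\<in>UNIV. A i j * z j)"
    by (simp add: lap_def sum_subtractf right_diff_distrib)
  also have "(\<Sum>i\<in>UNIV. \<Sum>j\<in>UNIV. A i j * z j) = (\<Sum>i\<in>UNIV. \<Sum>j\<in>UNIV. A i j * z i)"
    by (subst sum.swap) (simp add: assms)
  finally show ?thesis by simp
qed

text \<open>Summation by parts: exchanging \<open>i\<close> and \<open>j\<close> turns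
  \<open>z i * (z i - z j)\<close> into \<open>z j * (z j - z i)\<close>, and the two add up to a
  square.\<close>

lemma sum_mult_lap:
  assumes "\<And>i j. A i j = A j i"
  shows "(\<Sum>i\<in>UNIV. z i * lap A z i) = dirichlet A z / 2"
proof -
  have "(\<Sum>i\<in>UNIV. z i * lap A z i) = (\<Sum>i\<in>UNIV. \<Sum>j\<in>UNIV. A i j * (z i * (z i - z j)))" (is "?l = _")
    by (simp add: lap_def sum_distrib_left algebra_simps)
  moreover have "(\<Sum>i\<in>UNIV. \<Sum>j\<in>UNIV. A i j * (z i * (z i - z j))) =
      (\<Sum>i\<in>UNIV. \<Sum>j\<in>UNIV. A i j * (z j * (z j - z i)))"
    by (subst sum.swap) (simp add: assms)
  ultimately have "2 * ?l = (\<Sum>i\<in>UNIV. \<Sum>j\<in>UNIV. A i j * (z i * (z i - z j)) + A i j * (z j * (z j - z i)))"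
    by (simp add: sum.distrib)
  also have "\<dots> = dirichlet A z"
    unfolding dirichlet_def by (intro sum.cong refl) (simp add: power2_eq_square algebra_simps)
  finally show ?thesis by simp
qed

lemma dirichlet_nonneg: "(\<And>i j. 0 \<le> A i j) \<Longrightarrow> 0 \<le> dirichlet A z"
  unfolding dirichlet_def by (intro sum_nonneg mult_nonneg_nonneg) auto

lemma edge_le_dirichlet:
  assumes "\<And>i j. 0 \<le> A i j"
  shows "A i j * (z i - z j)\<^sup>2 \<le> dirichlet A z"
proof -
  have "A i j * (z i - z j)\<^sup>2 \<le> (\<Sum>j\<in>UNIV. A i j * (z i - z j)\<^sup>2)"
    using assms by (intro member_le_sum) auto
  also have "\<dots> \<le> dirichlet A z"
    unfolding dirichlet_def
    using assms by (intro member_le_sum[where f = "\<lambda>i. \<Sum>j\<in>UNIV. A i j * (z i - z j)\<^sup>2"] sum_nonneg) auto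
  finally show ?thesis .
qed

text \<open>Induction along a path from \<open>i\<close> to \<open>j\<close>: each edge costs its
  Dirichlet share divided by its weight. The constant depends on the path only, not on
  \<open>z\<close>.\<close>

lemma poincare_pair:
  assumes A: "\<And>i j. 0 \<le> A i j" and E: "\<And>i j. E i j \<Longrightarrow> 0 < A i j" and "E\<^sup>*\<^sup>* i j"
  shows "\<exists>C\<ge>0. \<forall>z. (z i - z j)\<^sup>2 \<le> C * dirichlet A z"
  using assms(3)
proof (induction rule: rtranclp_induct)
  case base then show ?case by (intro exI[of _ 0]) simp
next
  case (step j l)
  then obtain C where C: "C \<ge> 0" "\<And>z. (z i - z j)\<^sup>2 \<le> C * dirichlet A z" by blast
  have pos: "0 < A j l" using E step by blast
  show ?case
  proof (intro exI[of _ "2 * C + 2 / A j l"] conjI allI)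
    show "0 \<le> 2 * C + 2 / A j l" using C pos by simp
    fix z :: "'a \<Rightarrow> real"
    have 1: "(z j - z l)\<^sup>2 \<le> dirichlet A z / A j l"
      using edge_le_dirichlet[of A j l z] A pos by (simp add: field_simps)
    \<comment> \<open>The difference of the two sides is the square of
      \<open>z i - 2 * z j + z l\<close>, by the parallelogram law.\<close>
    have "(z i - z l)\<^sup>2 \<le> 2 * (z i - z j)\<^sup>2 + 2 * (z j - z l)\<^sup>2"
      using sum_squares_ge_zero[of "z i - 2 * z j + z l" 0] by (simp add: power2_eq_square algebra_simps)
    also have "\<dots> \<le> 2 * (C * dirichlet A z) + 2 * (dirichlet A z / A j l)"
      by (intro add_mono mult_left_mono C 1) auto
    finally show "(z i - z l)\<^sup>2 \<le> (2 * C + 2 / A j l) * dirichlet A z"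
      by (simp add: algebra_simps)
  qed
qed

lemma sum_sq_diff_mean_zero:
  fixes z :: "'v::finite \<Rightarrow> real"
  assumes "(\<Sum>i\<in>UNIV. z i) = 0"
  shows "(\<Sum>i\<in>UNIV. \<Sum>j\<in>UNIV. (z i - z j)\<^sup>2) = 2 * CARD('v) * (\<Sum>i\<in>UNIV. (z i)\<^sup>2)"
proof -
  have "(\<Sum>j\<in>UNIV. (z i - z j)\<^sup>2) = CARD('v) * (z i)\<^sup>2 - 2 * z i * (\<Sum>j\<in>UNIV. z j) + (\<Sum>j\<in>UNIV. (z j)\<^sup>2)" for i
    by (simp add: power2_diff sum.distrib sum_subtractf sum_distrib_left)
  then show ?thesis
    by (simp add: assms sum.distrib sum_distrib_left[symmetric])
qed

text \<open>For a vector of mean zero the squared norm is a multiple of the sum of all squared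
  pairwise differences, and each of these is bounded by the Dirichlet form since the graph is
  connected. No eigenvalues are involved; \<open>l\<close> is some valid constant.\<close>

lemma spectral_gap:
  fixes A :: "'v::finite \<Rightarrow> 'v \<Rightarrow> real"
  assumes A: "\<And>i j. 0 \<le> A i j" and E: "\<And>i j. E i j \<Longrightarrow> 0 < A i j" and conn: "\<And>i j. E\<^sup>*\<^sup>* i j"
  obtains l where "0 < l"
    "\<And>z. (\<Sum>i\<in>UNIV. z i) = 0 \<Longrightarrow> l * (\<Sum>i\<in>UNIV. (z i)\<^sup>2) \<le> dirichlet A z"
proof -
  obtain C where C: "\<And>i j. C i j \<ge> 0" "\<And>i j z. (z i - z j)\<^sup>2 \<le> C i j * dirichlet A z"
    using poincare_pair[of A E, OF A E conn] by metis
  \<comment> \<open>The summand 1 keeps the divisor positive even if all path constants vanish, as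
    on a single vertex.\<close>
  define D where "D = 1 + (\<Sum>i\<in>UNIV. \<Sum>j\<in>UNIV. C i j)"
  have D: "0 < D" unfolding D_def using C(1) by (intro add_pos_nonneg sum_nonneg) auto
  show ?thesis
  proof (rule that[of "2 * CARD('v) / D"])
    show "0 < 2 * CARD('v) / D" using D by simp
    fix z :: "'v \<Rightarrow> real" assume z: "(\<Sum>i\<in>UNIV. z i) = 0"
    have "2 * CARD('v) * (\<Sum>i\<in>UNIV. (z i)\<^sup>2) \<le> (\<Sum>i\<in>UNIV. \<Sum>j\<in>UNIV. C i j * dirichlet A z)"
      unfolding sum_sq_diff_mean_zero[OF z, symmetric] by (intro sum_mono C)
    also have "\<dots> \<le> D * dirichlet A z"
      unfolding D_def using dirichlet_nonneg[of A z, OF A] by (simp add: sum_distrib_right[symmetric] distrib_right)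
    finally show "2 * CARD('v) / D * (\<Sum>i\<in>UNIV. (z i)\<^sup>2) \<le> dirichlet A z"
      using D by (simp add: field_simps)
  qed
qed

text \<open>A crude operator bound by Cauchy-Schwarz in each row; it only has to control the
  second-order term of one iteration step.\<close>

lemma sum_lap_sq_le:
  fixes A :: "'v::finite \<Rightarrow> 'v \<Rightarrow> real"
  assumes z: "(\<Sum>i\<in>UNIV. z i) = 0"
  shows "(\<Sum>i\<in>UNIV. (lap A z i)\<^sup>2) \<le>
    (\<Sum>i\<in>UNIV. \<Sum>j\<in>UNIV. (A i j)\<^sup>2) * (2 * CARD('v)) * (\<Sum>i\<in>UNIV. (z i)\<^sup>2)"
proof -
  let ?a = "\<lambda>i. \<Sum>j\<in>UNIV. (A i j)\<^sup>2" and ?b = "\<lambda>i. \<Sum>j\<in>UNIV. (z i - z j)\<^sup>2"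
  have "(\<Sum>i\<in>UNIV. (lap A z i)\<^sup>2) \<le> (\<Sum>i\<in>UNIV. ?a i * ?b i)"
    unfolding lap_def by (intro sum_mono Cauchy_Schwarz_ineq_sum)
  also have "\<dots> \<le> (\<Sum>i\<in>UNIV. ?a i * (\<Sum>i\<in>UNIV. ?b i))"
    by (intro sum_mono mult_left_mono sum_nonneg member_le_sum) (auto intro: sum_nonneg)
  also have "\<dots> = (\<Sum>i\<in>UNIV. ?a i) * (2 * CARD('v) * (\<Sum>i\<in>UNIV. (z i)\<^sup>2))"
    by (simp only: sum_sq_diff_mean_zero[OF z] sum_distrib_right)
  finally show ?thesis by (simp add: mult.assoc)
qed

section \<open>Convergence of perturbed Laplacian iterations\<close>

text \<open>Both the Laplacian and \<open>r\<close> sum to zero, so the average is conserved and the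
  limit must be the initial average \<open>c\<close>. The squared deviation \<open>v\<close>
  contracts at rate \<open>l * a k\<close>: half of this absorbs the cross term with
  \<open>r\<close>, and eventually a quarter absorbs the terms of order \<open>(a k)\<^sup>2\<close>
  in \<open>v\<close>.\<close>

lemma laplacian_iteration_tendsto:
  fixes y r :: "nat \<Rightarrow> 'v::finite \<Rightarrow> real" and A :: "'v \<Rightarrow> 'v \<Rightarrow> real"
  assumes A: "\<And>i j. 0 \<le> A i j" and sym: "\<And>i j. A i j = A j i"
    and E: "\<And>i j. E i j \<Longrightarrow> 0 < A i j" and conn: "\<And>i j. E\<^sup>*\<^sup>* i j"
    and a: "\<And>k. 0 < a k" and div: "\<not> summable a" and a0: "a \<longlonglongrightarrow> 0"
    and r0: "\<And>i. (\<lambda>k. r k i) \<longlonglongrightarrow> 0" and sum_r: "\<And>k. (\<Sum>i\<in>UNIV. r k i) = 0"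
    and step: "\<And>k i. y (Suc k) i = y k i - a k * lap A (y k) i + a k * r k i"
  shows "\<exists>c. \<forall>i. (\<lambda>k. y k i) \<longlonglongrightarrow> c"
proof -
  define c where "c = (\<Sum>i\<in>UNIV. y 0 i) / CARD('v)"
  have sum_y: "(\<Sum>i\<in>UNIV. y k i) = CARD('v) * c" for k
    by (induction k) (simp_all add: c_def step sum.distrib sum_subtractf
        sum_distrib_left[symmetric] sum_lap_eq_0[of A, OF sym] sum_r)
  define z where "z k i = y k i - c" for k i
  have sum_z: "(\<Sum>i\<in>UNIV. z k i) = 0" for k
    by (simp add: z_def sum_subtractf sum_y)
  have step_z: "z (Suc k) i = z k i + a k * (r k i - lap A (z k) i)" for k i
    unfolding z_def lap_diff_const by (simp add: step algebra_simps)
  obtain l where l: "0 < l" "\<And>z. (\<Sum>i\<in>UNIV. z i) = 0 \<Longrightarrow> l * (\<Sum>i\<in>UNIV. (z i)\<^sup>2) \<le> dirichlet A z"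
    using spectral_gap[of A E, OF A E conn] by blast
  define K where "K = (\<Sum>i\<in>UNIV. \<Sum>j\<in>UNIV. (A i j)\<^sup>2) * (2 * CARD('v))"
  have K: "0 \<le> K" unfolding K_def by (intro mult_nonneg_nonneg sum_nonneg) auto
  define v where "v k = (\<Sum>i\<in>UNIV. (z k i)\<^sup>2)" for k
  define R where "R k = (\<Sum>i\<in>UNIV. (r k i)\<^sup>2)" for k
  have v: "0 \<le> v k" and R: "0 \<le> R k" for k by (auto simp: v_def R_def intro: sum_nonneg)
  have vstep: "v (Suc k) \<le> v k - a k * (l / 2) * v k + a k * (2 / l) * R k + (a k)\<^sup>2 * (2 * R k + 2 * K * v k)" for k
  proof -
    let ?g = "\<lambda>i. r k i - lap A (z k) i"
    have "v (Suc k) = (\<Sum>i\<in>UNIV. (z k i)\<^sup>2 + 2 * a k * (z k i * r k i) - 2 * a k * (z k i * lap A (z k) i) + (a k)\<^sup>2 * (?g i)\<^sup>2)"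
      unfolding v_def step_z by (intro sum.cong refl) (simp add: power2_eq_square algebra_simps)
    also have "\<dots> = v k + 2 * a k * (\<Sum>i\<in>UNIV. z k i * r k i) - a k * dirichlet A (z k) + (a k)\<^sup>2 * (\<Sum>i\<in>UNIV. (?g i)\<^sup>2)"
      by (simp add: v_def sum.distrib sum_subtractf sum_distrib_left[symmetric] sum_mult_lap[of A, OF sym])
    finally have vSuc: "v (Suc k) = v k + 2 * a k * (\<Sum>i\<in>UNIV. z k i * r k i) - a k * dirichlet A (z k) + (a k)\<^sup>2 * (\<Sum>i\<in>UNIV. (?g i)\<^sup>2)" .
    have g: "(\<Sum>i\<in>UNIV. (?g i)\<^sup>2) \<le> 2 * R k + 2 * K * v k"
    proof -
      have "(\<Sum>i\<in>UNIV. (?g i)\<^sup>2) \<le> (\<Sum>i\<in>UNIV. 2 * (r k i)\<^sup>2 + 2 * (lap A (z k) i)\<^sup>2)"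
      proof (rule sum_mono)
        show "(?g i)\<^sup>2 \<le> 2 * (r k i)\<^sup>2 + 2 * (lap A (z k) i)\<^sup>2" for i
          using zero_le_power2[of "r k i + lap A (z k) i"] by (simp add: power2_eq_square algebra_simps)
      qed
      also have "\<dots> \<le> 2 * R k + 2 * (K * v k)"
        using sum_lap_sq_le[OF sum_z[of k], of A]
        by (simp add: R_def v_def K_def sum.distrib sum_distrib_left[symmetric] mult.assoc mult.commute mult.left_commute)
      finally show ?thesis by simp
    qed
    \<comment> \<open>Young's inequality with weight \<open>l / 4\<close>, so that after the factor
      \<open>2 * a k\<close> exactly half of the dissipation \<open>l * a k * v k\<close> is
      spent.\<close>
    have "(\<Sum>i\<in>UNIV. z k i * r k i) \<le> (\<Sum>i\<in>UNIV. (l / 4) * (z k i)\<^sup>2 + (1 / l) * (r k i)\<^sup>2)"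
    proof (rule sum_mono)
      fix i
      have "0 \<le> (l * z k i - 2 * r k i)\<^sup>2" by simp
      then have "4 * l * (z k i * r k i) \<le> 4 * l * ((l / 4) * (z k i)\<^sup>2 + (1 / l) * (r k i)\<^sup>2)"
        using l(1) by (simp add: power2_eq_square algebra_simps)
      then show "z k i * r k i \<le> (l / 4) * (z k i)\<^sup>2 + (1 / l) * (r k i)\<^sup>2"
        using l(1) by simp
    qed
    also have "\<dots> = (l / 4) * v k + (1 / l) * R k"
      by (simp only: v_def R_def sum.distrib sum_distrib_left[symmetric])
    finally have "2 * a k * (\<Sum>i\<in>UNIV. z k i * r k i) \<le> 2 * a k * ((l / 4) * v k + (1 / l) * R k)"
      using a[of k] by (intro mult_left_mono) auto
    moreover have "a k * (l * v k) \<le> a k * dirichlet A (z k)"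
      using l(2)[OF sum_z[of k]] a[of k] by (intro mult_left_mono) (auto simp: v_def)
    moreover have "(a k)\<^sup>2 * (\<Sum>i\<in>UNIV. (?g i)\<^sup>2) \<le> (a k)\<^sup>2 * (2 * R k + 2 * K * v k)"
      by (intro mult_left_mono g) simp
    ultimately have "v (Suc k) \<le> v k + 2 * a k * ((l / 4) * v k + (1 / l) * R k) - a k * (l * v k) + (a k)\<^sup>2 * (2 * R k + 2 * K * v k)"
      unfolding vSuc by linarith
    also have "\<dots> = v k - a k * (l / 2) * v k + a k * (2 / l) * R k + (a k)\<^sup>2 * (2 * R k + 2 * K * v k)"
      by (simp add: algebra_simps)
    finally show ?thesis .
  qed
  have "v \<longlonglongrightarrow> 0"
  proof (rule contraction_with_vanishing_input_tendsto_0[OF v a _ div a0])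
    \<comment> \<open>What is left of the rate \<open>l\<close> after the losses
      \<open>l / 2\<close> and \<open>l / 4\<close>.\<close>
    show "0 < l / 4" using l by simp
    have "(\<lambda>k. (2 / l + 2 * a k) * (\<Sum>i\<in>UNIV. (r k i)\<^sup>2)) \<longlonglongrightarrow> (2 / l + 2 * 0) * (\<Sum>i::'v\<in>UNIV. 0\<^sup>2)"
      by (intro tendsto_intros a0 r0)
    then show "(\<lambda>k. (2 / l + 2 * a k) * R k) \<longlonglongrightarrow> 0"
      by (simp add: R_def)
    have "(\<lambda>k. 2 * K * a k) \<longlonglongrightarrow> 0" using tendsto_mult_right_zero[OF a0] .
    then have "\<forall>\<^sub>F k in sequentially. 2 * K * a k < l / 4" using l by (intro order_tendstoD(2)) auto
    then show "\<forall>\<^sub>F k in sequentially. v (Suc k) \<le> (1 - l / 4 * a k) * v k + a k * ((2 / l + 2 * a k) * R k)"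
    proof eventually_elim
      case (elim k)
      have "(2 * K * a k) * (a k * v k) \<le> l / 4 * (a k * v k)"
        using elim a[of k] v[of k] by (intro mult_right_mono) auto
      with vstep[of k] show ?case by (simp add: power2_eq_square algebra_simps)
    qed
  qed
  have "(\<lambda>k. z k i) \<longlonglongrightarrow> 0" for i
  proof -
    have "norm ((z k i)\<^sup>2) \<le> v k" for k
      using member_le_sum[of i UNIV "\<lambda>i. (z k i)\<^sup>2"] by (simp add: v_def)
    then have "(\<lambda>k. (z k i)\<^sup>2) \<longlonglongrightarrow> 0"
      using \<open>v \<longlonglongrightarrow> 0\<close> by (intro Lim_null_comparison[of "\<lambda>k. (z k i)\<^sup>2" v]) auto
    then show ?thesis by (simp only: power_tendsto_0_iff zero_less_numeral)
  qed
  then have "(\<lambda>k. y k i) \<longlonglongrightarrow> c" for i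
    using LIM_zero_iff[of "\<lambda>k. y k i" c sequentially] by (simp add: z_def)
  then show ?thesis by blast
qed

text \<open>Shifting the trajectory by the tail of the noise series turns a summable perturbation into
  a perturbation of the form \<open>a k * r k i\<close> with \<open>r k i\<close> vanishing.\<close>
lemma perturbed_laplacian_iteration_tendsto:
  fixes x w :: "nat \<Rightarrow> 'v::finite \<Rightarrow> real" and A :: "'v \<Rightarrow> 'v \<Rightarrow> real"
  assumes A: "\<And>i j. 0 \<le> A i j" and sym: "\<And>i j. A i j = A j i"
    and E: "\<And>i j. E i j \<Longrightarrow> 0 < A i j" and conn: "\<And>i j. E\<^sup>*\<^sup>* i j"
    and a: "\<And>k. 0 < a k" and div: "\<not> summable a" and a0: "a \<longlonglongrightarrow> 0"
    and w: "\<And>i. summable (\<lambda>k. w k i)"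
    and step: "\<And>k i. x (Suc k) i = x k i - a k * lap A (x k) i + w k i"
  shows "\<exists>c. \<forall>i. (\<lambda>k. x k i) \<longlonglongrightarrow> c"
proof -
  define t where "t k i = (\<Sum>l. w (l + k) i)" for k i
  have t0: "(\<lambda>k. t k i) \<longlonglongrightarrow> 0" for i
    unfolding t_def by (rule suminf_exist_split2[OF w])
  have t_Suc: "t (Suc k) i = t k i - w k i" for k i
    using suminf_split_head[OF summable_ignore_initial_segment[OF w, of k i]] by (simp add: t_def)
  \<comment> \<open>The shift by \<open>t\<close> replaces the noise by the error of applying the
    Laplacian to \<open>x + t\<close> instead of \<open>x\<close>. By linearity this error is
    \<open>lap A (t k)\<close>, which vanishes in the limit and sums to zero.\<close>
  have "\<exists>c. \<forall>i. (\<lambda>k. x k i + t k i) \<longlonglongrightarrow> c"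
  proof (rule laplacian_iteration_tendsto[OF A sym E conn a div a0, where r = "\<lambda>k. lap A (t k)"])
    have "(\<lambda>k. lap A (t k) i) \<longlonglongrightarrow> (\<Sum>j\<in>UNIV. A i j * (0 - 0))" for i
      unfolding lap_def by (intro tendsto_intros t0)
    then show "(\<lambda>k. lap A (t k) i) \<longlonglongrightarrow> 0" for i by simp
    show "(\<Sum>i\<in>UNIV. lap A (t k) i) = 0" for k by (rule sum_lap_eq_0[OF sym])
    show "x (Suc k) i + t (Suc k) i =
        x k i + t k i - a k * lap A (\<lambda>i. x k i + t k i) i + a k * lap A (t k) i" for k i
      by (simp add: lap_add step t_Suc algebra_simps)
  qed
  then obtain c where c: "\<And>i. (\<lambda>k. x k i + t k i) \<longlonglongrightarrow> c" by blast
  have "(\<lambda>k. x k i) \<longlonglongrightarrow> c" for i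
    using tendsto_diff[OF c[of i] t0[of i]] by simp
  then show ?thesis by blast
qed

section \<open>Square-integrable martingales\<close>

lemma integrable_mult_of_squares:
  fixes f g :: "'a \<Rightarrow> real"
  assumes [measurable]: "f \<in> borel_measurable M" "g \<in> borel_measurable M"
    and "integrable M (\<lambda>x. (f x)\<^sup>2)" "integrable M (\<lambda>x. (g x)\<^sup>2)"
  shows "integrable M (\<lambda>x. f x * g x)"
proof (rule Bochner_Integration.integrable_bound[of M "\<lambda>x. (f x)\<^sup>2 + (g x)\<^sup>2"])
  have "\<bar>a * b\<bar> \<le> a\<^sup>2 + b\<^sup>2" for a b :: real
  proof -
    have "0 \<le> \<bar>a\<bar> * \<bar>b\<bar>" by simp
    moreover have "2 * \<bar>a\<bar> * \<bar>b\<bar> \<le> a\<^sup>2 + b\<^sup>2"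
      using sum_squares_bound[of "\<bar>a\<bar>" "\<bar>b\<bar>"] by simp
    ultimately show ?thesis unfolding abs_mult by linarith
  qed
  then show "AE x in M. norm (f x * g x) \<le> norm ((f x)\<^sup>2 + (g x)\<^sup>2)" by simp
qed (use assms in auto)

text \<open>\<open>X_orth\<close> expresses that the conditional mean of \<open>X k\<close> given
  \<open>F k\<close> is zero, tested against square-integrable functions. The index matters:
  \<open>F k\<close> is the information before \<open>X k\<close>, which becomes measurable at
  \<open>Suc k\<close>.\<close>

locale L2_martingale_differences = prob_space +
  fixes F :: "nat \<Rightarrow> 'a measure" and X :: "nat \<Rightarrow> 'a \<Rightarrow> real"
  assumes F_sub: "\<And>k. subalgebra M (F k)"
    and F_mono: "\<And>k l. k \<le> l \<Longrightarrow> sets (F k) \<subseteq> sets (F l)"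
    and X_adapted: "\<And>k. X k \<in> borel_measurable (F (Suc k))"
    and X_sq: "\<And>k. integrable M (\<lambda>\<omega>. (X k \<omega>)\<^sup>2)"
    and X_orth: "\<And>k Z. Z \<in> borel_measurable (F k) \<Longrightarrow> integrable M (\<lambda>\<omega>. (Z \<omega>)\<^sup>2) \<Longrightarrow>
      (\<integral>\<omega>. Z \<omega> * X k \<omega> \<partial>M) = 0"
begin

lemma space_F: "space (F k) = space M"
  using F_sub[of k] by (simp add: subalgebra_def)

lemma measurable_F_mono: "f \<in> borel_measurable (F k) \<Longrightarrow> k \<le> l \<Longrightarrow> f \<in> borel_measurable (F l)"
  using F_mono[of k l] by (auto simp: measurable_def space_F)

lemma measurable_F: "f \<in> borel_measurable (F k) \<Longrightarrow> f \<in> borel_measurable M"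
  using F_sub[of k] by (rule measurable_from_subalg)

lemma X_measurable [measurable]: "X k \<in> borel_measurable M"
  using X_adapted by (rule measurable_F)

lemma partial_sum_adapted: "(\<lambda>\<omega>. \<Sum>k<n. X k \<omega>) \<in> borel_measurable (F n)"
  by (intro borel_measurable_sum measurable_F_mono[OF X_adapted]) auto

text \<open>Pythagoras: the sum of the terms before \<open>n\<close> is a legitimate test function
  for \<open>X n\<close>. Integrability is carried through the induction because
  \<open>X_orth\<close> requires it.\<close>

lemma partial_sum_sq:
  "integrable M (\<lambda>\<omega>. (\<Sum>k<n. X k \<omega>)\<^sup>2) \<and>
   (\<integral>\<omega>. (\<Sum>k<n. X k \<omega>)\<^sup>2 \<partial>M) = (\<Sum>k<n. \<integral>\<omega>. (X k \<omega>)\<^sup>2 \<partial>M)"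
proof (induction n)
  case (Suc n)
  let ?S = "\<lambda>\<omega>. \<Sum>k<n. X k \<omega>"
  have int: "integrable M (\<lambda>\<omega>. ?S \<omega> * X n \<omega>)"
    using Suc X_sq by (intro integrable_mult_of_squares) auto
  have eq: "(\<Sum>k<Suc n. X k \<omega>)\<^sup>2 = (?S \<omega>)\<^sup>2 + (X n \<omega>)\<^sup>2 + 2 * (?S \<omega> * X n \<omega>)" for \<omega>
    by (simp add: power2_eq_square algebra_simps)
  have "(\<integral>\<omega>. ?S \<omega> * X n \<omega> \<partial>M) = 0"
    using Suc by (intro X_orth partial_sum_adapted) auto
  then show ?case
    unfolding eq using Suc X_sq int by simp
qed simp

lemma shift: "L2_martingale_differences M (\<lambda>k. F (k + m)) (\<lambda>k. X (k + m))"
  using F_sub F_mono X_adapted X_sq X_orth by unfold_locales auto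

text \<open>The maximal inequality applies Chebyshev's inequality to the martingale stopped on first
  leaving the interval \<open>(-e, e)\<close>; its differences are again orthogonal to the past.\<close>
lemma kolmogorov_maximal_inequality:
  assumes e: "0 < e"
  shows "prob {\<omega> \<in> space M. \<exists>m\<le>n. e \<le> \<bar>\<Sum>k<m. X k \<omega>\<bar>} \<le> (\<Sum>k<n. \<integral>\<omega>. (X k \<omega>)\<^sup>2 \<partial>M) / e\<^sup>2"
proof -
  \<comment> \<open>\<open>B j\<close> is the event that no exit has occurred up to
    \<open>j\<close>. It belongs to \<open>F j\<close>, so multiplying \<open>X j\<close> by its
    indicator preserves orthogonality; the increment that causes the exit is still included.\<close>
  define B where "B j = {\<omega> \<in> space M. \<forall>m\<le>j. \<bar>\<Sum>k<m. X k \<omega>\<bar> < e}" for j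
  have B_F: "B j \<in> sets (F j)" for j
  proof -
    have "{\<omega> \<in> space (F j). \<bar>\<Sum>k<m. X k \<omega>\<bar> < e} \<in> sets (F j)" if "m \<in> {..j}" for m
    proof -
      have [measurable]: "(\<lambda>\<omega>. \<Sum>k<m. X k \<omega>) \<in> borel_measurable (F j)"
        using that by (intro measurable_F_mono[OF partial_sum_adapted]) simp
      show ?thesis by measurable
    qed
    then have "{\<omega> \<in> space (F j). \<forall>m\<in>{..j}. \<bar>\<Sum>k<m. X k \<omega>\<bar> < e} \<in> sets (F j)"
      by (rule sets.sets_Collect_finite_All) auto
    then show ?thesis by (simp only: B_def space_F atMost_iff Ball_def)
  qed
  have B_M [measurable]: "B j \<in> sets M" for j
    using B_F F_sub[of j] by (auto simp: subalgebra_def)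
  define Y where "Y j \<omega> = indicator (B j) \<omega> * X j \<omega>" for j \<omega>
  have Y_sq_le: "(Y j \<omega>)\<^sup>2 \<le> (X j \<omega>)\<^sup>2" for j \<omega>
    by (simp add: Y_def indicator_def)
  have Y_M: "Y j \<in> borel_measurable M" for j
    unfolding Y_def by measurable
  have Y_sq: "integrable M (\<lambda>\<omega>. (Y j \<omega>)\<^sup>2)" for j
    by (rule Bochner_Integration.integrable_bound[OF X_sq[of j]]) (use Y_sq_le in \<open>auto intro!: borel_measurable_power Y_M\<close>)
  interpret Y: L2_martingale_differences M F Y
  proof
    show "subalgebra M (F k)" for k by (rule F_sub)
    show "sets (F k) \<subseteq> sets (F l)" if "k \<le> l" for k l by (rule F_mono[OF that])
    have "indicator (B k) \<in> borel_measurable (F (Suc k))" for k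
      using B_F[of k] F_mono[of k "Suc k"] by (intro borel_measurable_indicator) auto
    then show "Y k \<in> borel_measurable (F (Suc k))" for k
      unfolding Y_def by (intro borel_measurable_times X_adapted)
    show "integrable M (\<lambda>\<omega>. (Y k \<omega>)\<^sup>2)" for k by (rule Y_sq)
    show "(\<integral>\<omega>. Z \<omega> * Y k \<omega> \<partial>M) = 0"
      if Z: "Z \<in> borel_measurable (F k)" "integrable M (\<lambda>\<omega>. (Z \<omega>)\<^sup>2)" for k Z
    proof -
      have "(\<lambda>\<omega>. Z \<omega> * indicator (B k) \<omega>) \<in> borel_measurable (F k)"
        using Z(1) B_F by (intro borel_measurable_times borel_measurable_indicator)
      moreover from this have "integrable M (\<lambda>\<omega>. (Z \<omega> * indicator (B k) \<omega>)\<^sup>2)"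
        using Z measurable_F by (intro Bochner_Integration.integrable_bound[OF Z(2)])
          (auto simp: indicator_def intro!: borel_measurable_power)
      ultimately show ?thesis
        using X_orth[of "\<lambda>\<omega>. Z \<omega> * indicator (B k) \<omega>" k] by (simp add: Y_def mult.assoc)
    qed
  qed
  let ?T = "\<lambda>\<omega>. \<Sum>k<n. Y k \<omega>"
  \<comment> \<open>On this event the stopped sum at \<open>n\<close> equals the partial sum at the
    first exit \<open>l\<close>, which already has modulus at least \<open>e\<close>.\<close>
  have "{\<omega> \<in> space M. \<exists>m\<le>n. e \<le> \<bar>\<Sum>k<m. X k \<omega>\<bar>} \<subseteq> {\<omega> \<in> space M. e\<^sup>2 \<le> (?T \<omega>)\<^sup>2}"
  proof safe
    fix \<omega> m assume \<omega>: "\<omega> \<in> space M" and m: "m \<le> n" "e \<le> \<bar>\<Sum>k<m. X k \<omega>\<bar>"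
    define l where "l = (LEAST m. e \<le> \<bar>\<Sum>k<m. X k \<omega>\<bar>)"
    have l: "e \<le> \<bar>\<Sum>k<l. X k \<omega>\<bar>" unfolding l_def by (rule LeastI[of _ m]) (rule m)
    have l_least: "l \<le> j" if "e \<le> \<bar>\<Sum>k<j. X k \<omega>\<bar>" for j
      unfolding l_def using that by (rule Least_le)
    have "\<omega> \<in> B j \<longleftrightarrow> j < l" for j
    proof
      assume "\<omega> \<in> B j"
      then have "\<not> l \<le> j" using l unfolding B_def by fastforce
      then show "j < l" by simp
    next
      assume "j < l"
      then have "\<bar>\<Sum>k<m. X k \<omega>\<bar> < e" if "m \<le> j" for m
        using l_least[of m] that by linarith
      then show "\<omega> \<in> B j" using \<omega> unfolding B_def by blast
    qed
    then have "?T \<omega> = (\<Sum>k<n. if k < l then X k \<omega> else 0)"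
      by (intro sum.cong refl) (auto simp: Y_def)
    also have "\<dots> = (\<Sum>k\<in>{..<n} \<inter> {..<l}. X k \<omega>)"
      by (simp add: sum.inter_restrict)
    also have "{..<n} \<inter> {..<l} = {..<l}"
      using l_least[OF m(2)] m(1) by auto
    finally show "e\<^sup>2 \<le> (?T \<omega>)\<^sup>2" using abs_le_square_iff[of e "?T \<omega>"] l e by simp
  qed
  then have "prob {\<omega> \<in> space M. \<exists>m\<le>n. e \<le> \<bar>\<Sum>k<m. X k \<omega>\<bar>} \<le> prob {\<omega> \<in> space M. e\<^sup>2 \<le> (?T \<omega>)\<^sup>2}"
    using Y_M by (intro finite_measure_mono) auto
  also have "\<dots> \<le> (\<integral>\<omega>. (?T \<omega>)\<^sup>2 \<partial>M) / e\<^sup>2"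
    using e Y.partial_sum_sq by (intro integral_Markov_inequality_measure[where A = "{}"]) auto
  also have "\<dots> = (\<Sum>k<n. \<integral>\<omega>. (Y k \<omega>)\<^sup>2 \<partial>M) / e\<^sup>2"
    using Y.partial_sum_sq by simp
  also have "\<dots> \<le> (\<Sum>k<n. \<integral>\<omega>. (X k \<omega>)\<^sup>2 \<partial>M) / e\<^sup>2"
    by (intro divide_right_mono sum_mono integral_mono Y_sq X_sq Y_sq_le) simp
  finally show ?thesis .
qed

text \<open>The bound of the maximal inequality is uniform in the horizon, so continuity from below
  removes the horizon.\<close>

lemma prob_ever_exceeds_le:
  assumes e: "0 < e" and sum: "summable (\<lambda>k. \<integral>\<omega>. (X k \<omega>)\<^sup>2 \<partial>M)"
  shows "prob {\<omega> \<in> space M. \<exists>m. e \<le> \<bar>\<Sum>k<m. X k \<omega>\<bar>} \<le> (\<Sum>k. \<integral>\<omega>. (X k \<omega>)\<^sup>2 \<partial>M) / e\<^sup>2"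
proof -
  define A where "A n = {\<omega> \<in> space M. \<exists>m\<le>n. e \<le> \<bar>\<Sum>k<m. X k \<omega>\<bar>}" for n
  have "(\<lambda>n. prob (A n)) \<longlonglongrightarrow> prob (\<Union>n. A n)"
  proof (rule finite_Lim_measure_incseq)
    show "range A \<subseteq> sets M" unfolding A_def by auto
    show "incseq A" unfolding A_def by (intro monoI) (blast intro: order_trans)
  qed
  moreover have "(\<Union>n. A n) = {\<omega> \<in> space M. \<exists>m. e \<le> \<bar>\<Sum>k<m. X k \<omega>\<bar>}"
    by (auto simp: A_def)
  moreover have "prob (A n) \<le> (\<Sum>k. \<integral>\<omega>. (X k \<omega>)\<^sup>2 \<partial>M) / e\<^sup>2" for n
    unfolding A_def
    by (rule order_trans[OF kolmogorov_maximal_inequality[OF e]])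
      (intro divide_right_mono sum_le_suminf sum; simp)
  ultimately show ?thesis
    by (intro LIMSEQ_le_const2[of "\<lambda>n. prob (A n)"]) auto
qed

text \<open>Applied to the tails, the maximal inequality bounds the oscillation beyond
  \<open>m\<close> by a tail of the variance series; almost every path is therefore Cauchy.\<close>

lemma AE_summable:
  assumes sum: "summable (\<lambda>k. \<integral>\<omega>. (X k \<omega>)\<^sup>2 \<partial>M)"
  shows "AE \<omega> in M. summable (\<lambda>k. X k \<omega>)"
proof -
  let ?s = "\<lambda>m. \<Sum>k. \<integral>\<omega>. (X (k + m) \<omega>)\<^sup>2 \<partial>M"
  have "AE \<omega> in M. \<exists>m. \<forall>j. \<bar>\<Sum>k<j. X (k + m) \<omega>\<bar> < inverse (Suc q)" for q
  proof -
    define e where "e = inverse (real (Suc q))"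
    have e: "0 < e" by (simp add: e_def)
    define B where "B m = {\<omega> \<in> space M. \<exists>j. e \<le> \<bar>\<Sum>k<j. X (k + m) \<omega>\<bar>}" for m
    have [measurable]: "B m \<in> sets M" for m unfolding B_def by measurable
    have "prob (B m) \<le> ?s m / e\<^sup>2" for m
    proof -
      interpret S: L2_martingale_differences M "\<lambda>k. F (k + m)" "\<lambda>k. X (k + m)" by (rule shift)
      show ?thesis unfolding B_def
        by (rule S.prob_ever_exceeds_le[OF e]) (rule summable_ignore_initial_segment[OF sum])
    qed
    \<comment> \<open>The intersection lies in every \<open>B m\<close>, so it inherits all these
      bounds at once, and they tend to zero.\<close>
    then have "prob (\<Inter>m. B m) \<le> ?s m / e\<^sup>2" for m
      by (rule order_trans[rotated]) (auto intro!: finite_measure_mono)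
    moreover have "(\<lambda>m. ?s m / e\<^sup>2) \<longlonglongrightarrow> 0 / e\<^sup>2"
      by (intro tendsto_intros suminf_exist_split2 sum) (use e in auto)
    ultimately have "prob (\<Inter>m. B m) \<le> 0"
      by (intro LIMSEQ_le_const[of "\<lambda>m. ?s m / e\<^sup>2"]) auto
    then have "prob (\<Inter>m. B m) = 0"
      by (simp add: antisym)
    then have "AE \<omega> in M. \<omega> \<notin> (\<Inter>m. B m)"
      by (intro AE_not_in) (auto simp: null_sets_def emeasure_eq_measure)
    then show ?thesis
      using AE_space
    proof eventually_elim
      case (elim \<omega>) then show ?case unfolding B_def e_def by (simp add: not_le)
    qed
  qed
  then have "AE \<omega> in M. \<forall>q. \<exists>m. \<forall>j. \<bar>\<Sum>k<j. X (k + m) \<omega>\<bar> < inverse (Suc q)"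
    by (simp add: AE_all_countable)
  then show ?thesis
  proof eventually_elim
    case (elim \<omega>)
    have "Cauchy (\<lambda>n. \<Sum>k<n. X k \<omega>)"
    proof (rule CauchyI')
      fix e :: real assume "0 < e"
      then obtain q where q: "inverse (real (Suc q)) < e / 2"
        using reals_Archimedean[of "e / 2"] by auto
      from elim obtain m where m: "\<And>j. \<bar>\<Sum>k<j. X (k + m) \<omega>\<bar> < inverse (Suc q)" by blast
      have d: "\<bar>(\<Sum>i<n. X i \<omega>) - (\<Sum>i<m. X i \<omega>)\<bar> < e / 2" if "n \<ge> m" for n
      proof -
        have "(\<Sum>k<n. X k \<omega>) = (\<Sum>k<m. X k \<omega>) + (\<Sum>k<n - m. X (k + m) \<omega>)"
          using that sum.atLeastLessThan_concat[of 0 m n "\<lambda>k. X k \<omega>"] sum.shift_bounds_nat_ivl[of "\<lambda>k. X k \<omega>" 0 m "n - m"]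
          by (simp add: lessThan_atLeast0)
        with m[of "n - m"] q show ?thesis by simp
      qed
      show "\<exists>N. \<forall>n\<ge>N. \<forall>k>n. dist (\<Sum>i<n. X i \<omega>) (\<Sum>i<k. X i \<omega>) < e"
      proof (intro exI[of _ m] allI impI)
        fix n k assume "m \<le> n" "n < k"
        with d[of n] d[of k] show "dist (\<Sum>i<n. X i \<omega>) (\<Sum>i<k. X i \<omega>) < e"
          unfolding dist_real_def by linarith
      qed
    qed
    then show ?case
      by (simp add: summable_iff_convergent Cauchy_convergent_iff)
  qed
qed

end

section \<open>Moments of complex Gaussian variables\<close>

text \<open>The variance \<open>s\<close> is split evenly: real and imaginary parts are independent
  centred normals of variance \<open>s / 2\<close>.\<close>

lemma cn_density_eq_normal_density:
  assumes "0 < s"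
  shows "cn_density s z = normal_density 0 (sqrt (s / 2)) (Re z) * normal_density 0 (sqrt (s / 2)) (Im z)"
proof -
  have "2 * (sqrt (s / 2))\<^sup>2 = s" "2 * pi * (sqrt (s / 2))\<^sup>2 = pi * s"
    using assms by simp_all
  then have "normal_density 0 (sqrt (s / 2)) x = exp (- x\<^sup>2 / s) / sqrt (pi * s)" for x
    unfolding normal_density_def by (simp only: diff_zero) simp
  moreover have "sqrt (pi * s) * sqrt (pi * s) = pi * s"
    using assms by simp
  ultimately show ?thesis
    unfolding cn_density_def by (simp add: cmod_power2 exp_add[symmetric] add_divide_distrib diff_divide_distrib)
qed

lemma cn_density_nonneg: "0 < s \<Longrightarrow> 0 \<le> cn_density s z"
  by (simp add: cn_density_def)

lemma nn_integral_complex_lborel_prod: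
  fixes f g :: "real \<Rightarrow> ennreal"
  assumes [measurable]: "f \<in> borel_measurable borel" "g \<in> borel_measurable borel"
  shows "(\<integral>\<^sup>+z. f (Re z) * g (Im z) \<partial>lborel) = (\<integral>\<^sup>+x. f x \<partial>lborel) * (\<integral>\<^sup>+x. g x \<partial>lborel)"
proof -
  have ne: "(1::complex) \<noteq> \<i>" by (simp add: complex_eq_iff)
  have "(\<integral>\<^sup>+z. (\<Prod>b\<in>Basis. (if b = 1 then f else g) (z \<bullet> b)) \<partial>(lborel :: complex measure)) =
      (\<Prod>b\<in>Basis. \<integral>\<^sup>+x. (if b = (1::complex) then f else g) x \<partial>lborel)"
    by (rule nn_integral_lborel_prod) auto
  then show ?thesis using ne by (simp add: Basis_complex_def)
qed

text \<open>The constant is the even moment of a centred normal variable of variance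
  \<open>s / 2\<close>, where \<open>4 / s\<close> is twice the inverse variance. It equals
  \<open>s / 2\<close> for \<open>m = 1\<close> and \<open>3 * s\<^sup>2 / 4\<close> for
  \<open>m = 2\<close>.\<close>

lemma nn_integral_cn_density_moments:
  assumes s: "0 < s"
  shows "(\<integral>\<^sup>+z. ennreal (cn_density s z * (Re z)^(2 * m)) \<partial>lborel) = ennreal (fact (2 * m) / ((4 / s)^m * fact m))" (is "?R = _")
    and "(\<integral>\<^sup>+z. ennreal (cn_density s z * (Im z)^(2 * m)) \<partial>lborel) = ennreal (fact (2 * m) / ((4 / s)^m * fact m))" (is "?I = _")
proof -
  let ?\<phi> = "normal_density 0 (sqrt (s / 2))"
  let ?c = "fact (2 * m) / ((4 / s)^m * fact m) :: real"
  have \<sigma>: "0 < sqrt (s / 2)" using s by simp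
  have "has_bochner_integral lborel (\<lambda>x. ?\<phi> x * x ^ (2 * m)) ?c"
    using normal_moment_even[OF \<sigma>, of 0 m] s by simp
  then have 1: "(\<integral>\<^sup>+x. ennreal (?\<phi> x * x ^ (2 * m)) \<partial>lborel) = ennreal ?c"
    by (subst nn_integral_eq_integral) (auto simp: has_bochner_integral_iff)
  have 2: "(\<integral>\<^sup>+x. ennreal (?\<phi> x) \<partial>lborel) = 1"
    using \<sigma> by (subst nn_integral_eq_integral) (auto simp: integral_normal_density)
  have "?R = (\<integral>\<^sup>+z. ennreal (?\<phi> (Re z) * Re z ^ (2 * m)) * ennreal (?\<phi> (Im z)) \<partial>lborel)"
    by (intro nn_integral_cong)
      (simp add: cn_density_eq_normal_density[OF s] ennreal_mult[symmetric] mult.assoc mult.left_commute mult.commute power_mult)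
  also have "\<dots> = ennreal ?c"
    by (subst nn_integral_complex_lborel_prod) (simp_all add: 1 2)
  finally show "?R = ennreal ?c" .
  have "?I = (\<integral>\<^sup>+z. ennreal (?\<phi> (Re z)) * ennreal (?\<phi> (Im z) * Im z ^ (2 * m)) \<partial>lborel)"
    by (intro nn_integral_cong)
      (simp add: cn_density_eq_normal_density[OF s] ennreal_mult[symmetric] mult.assoc mult.left_commute mult.commute power_mult)
  also have "\<dots> = ennreal ?c"
    by (subst nn_integral_complex_lborel_prod) (simp_all add: 1 2)
  finally show "?I = ennreal ?c" .
qed

context
  fixes M :: "'a measure" and X :: "'a \<Rightarrow> complex" and s :: real
  assumes s: "0 < s" and X: "distributed M lborel X (\<lambda>z. ennreal (cn_density s z))"
begin

lemma cn_Re_Im_moments: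
  shows "has_bochner_integral M (\<lambda>\<omega>. (Re (X \<omega>)) ^ (2 * m)) (fact (2 * m) / ((4 / s)^m * fact m))"
    and "has_bochner_integral M (\<lambda>\<omega>. (Im (X \<omega>)) ^ (2 * m)) (fact (2 * m) / ((4 / s)^m * fact m))"
proof -
  have [measurable]: "X \<in> borel_measurable M"
    using distributed_measurable[OF X] by simp
  have "(\<integral>\<^sup>+\<omega>. ennreal ((Re (X \<omega>)) ^ (2 * m)) \<partial>M) = ennreal (fact (2 * m) / ((4 / s)^m * fact m))"
    by (subst distributed_nn_integral[OF X, of "\<lambda>z. ennreal ((Re z) ^ (2 * m))", symmetric])
      (simp_all add: ennreal_mult[symmetric] cn_density_nonneg s nn_integral_cn_density_moments(1))
  then show "has_bochner_integral M (\<lambda>\<omega>. (Re (X \<omega>)) ^ (2 * m)) (fact (2 * m) / ((4 / s)^m * fact m))"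
    using s by (intro has_bochner_integral_nn_integral) auto
  have "(\<integral>\<^sup>+\<omega>. ennreal ((Im (X \<omega>)) ^ (2 * m)) \<partial>M) = ennreal (fact (2 * m) / ((4 / s)^m * fact m))"
    by (subst distributed_nn_integral[OF X, of "\<lambda>z. ennreal ((Im z) ^ (2 * m))", symmetric])
      (simp_all add: ennreal_mult[symmetric] cn_density_nonneg s nn_integral_cn_density_moments(2))
  then show "has_bochner_integral M (\<lambda>\<omega>. (Im (X \<omega>)) ^ (2 * m)) (fact (2 * m) / ((4 / s)^m * fact m))"
    using s by (intro has_bochner_integral_nn_integral) auto
qed

lemma cn_norm_sq: "has_bochner_integral M (\<lambda>\<omega>. (cmod (X \<omega>))\<^sup>2) s"
  using has_bochner_integral_add[OF cn_Re_Im_moments[of 1]] s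
  by (simp add: cmod_power2)

text \<open>The constant 3 comes from bounding the fourth power of the modulus by twice the sum of
  the fourth powers of both parts, each with mean \<open>3 * s\<^sup>2 / 4\<close>.\<close>

lemma cn_fourth_moment: "integrable M (\<lambda>\<omega>. (cmod (X \<omega>)) ^ 4)" "(\<integral>\<omega>. (cmod (X \<omega>)) ^ 4 \<partial>M) \<le> 3 * s\<^sup>2"
proof -
  have [measurable]: "X \<in> borel_measurable M"
    using distributed_measurable[OF X] by simp
  have hb: "has_bochner_integral M (\<lambda>\<omega>. 2 * ((Re (X \<omega>)) ^ 4 + (Im (X \<omega>)) ^ 4)) (3 * s\<^sup>2)"
    using has_bochner_integral_mult_right[of 2, OF has_bochner_integral_add[OF cn_Re_Im_moments[of 2]]] s
    by (simp add: fact_numeral power2_eq_square)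
  have le: "(cmod z) ^ 4 \<le> 2 * ((Re z) ^ 4 + (Im z) ^ 4)" for z
  proof -
    have "(cmod z) ^ 4 = ((Re z)\<^sup>2 + (Im z)\<^sup>2)\<^sup>2"
      by (simp add: cmod_power2[symmetric] power_mult[symmetric])
    also have "\<dots> \<le> 2 * (((Re z)\<^sup>2)\<^sup>2 + ((Im z)\<^sup>2)\<^sup>2)"
      using zero_le_power2[of "(Re z)\<^sup>2 - (Im z)\<^sup>2"] by (simp add: power2_sum power2_diff)
    finally show ?thesis by (simp add: power_mult[symmetric])
  qed
  have "integrable M (\<lambda>\<omega>. 2 * ((Re (X \<omega>)) ^ 4 + (Im (X \<omega>)) ^ 4))"
    using hb by (simp only: has_bochner_integral_iff)
  then show i: "integrable M (\<lambda>\<omega>. (cmod (X \<omega>)) ^ 4)"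
    by (rule Bochner_Integration.integrable_bound) (use le in \<open>auto intro: order_trans[OF _ abs_ge_self]\<close>)
  have "(\<integral>\<omega>. (cmod (X \<omega>)) ^ 4 \<partial>M) \<le> (\<integral>\<omega>. 2 * ((Re (X \<omega>)) ^ 4 + (Im (X \<omega>)) ^ 4) \<partial>M)"
    using hb by (intro integral_mono i le) (simp only: has_bochner_integral_iff)
  with hb show "(\<integral>\<omega>. (cmod (X \<omega>)) ^ 4 \<partial>M) \<le> 3 * s\<^sup>2"
    by (simp only: has_bochner_integral_iff)
qed

text \<open>The density is even and Lebesgue measure is invariant under negation, so the integral
  equals its own negative.\<close>

lemma cn_mean_zero: "(\<integral>\<omega>. X \<omega> \<partial>M) = 0"
proof -
  have dm [measurable]: "cn_density s \<in> borel_measurable borel"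
    unfolding cn_density_def by measurable
  let ?f = "\<lambda>z. cn_density s z *\<^sub>R z"
  have "(\<integral>\<omega>. X \<omega> \<partial>M) = (\<integral>z. z \<partial>distr M lborel X)"
    using distributed_measurable[OF X] by (subst integral_distr) auto
  also have "\<dots> = (\<integral>z. z \<partial>density lborel (\<lambda>z. ennreal (cn_density s z)))"
    by (simp only: distributed_distr_eq_density[OF X])
  also have "\<dots> = (\<integral>z. ?f z \<partial>lborel)"
    by (rule integral_density) (auto simp: cn_density_nonneg s)
  finally have 1: "(\<integral>\<omega>. X \<omega> \<partial>M) = (\<integral>z. ?f z \<partial>lborel)" .
  have l: "(lborel :: complex measure) = distr lborel borel uminus"
    using lborel_affine[of "-1" "0::complex"] by (simp add: density_1 uminus_add_conv_diff)
  have "(\<integral>z. ?f z \<partial>lborel) = (\<integral>z. ?f z \<partial>distr lborel borel uminus)"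
    by (subst l) (rule refl)
  also have "\<dots> = (\<integral>z. ?f (- z) \<partial>lborel)"
    by (rule integral_distr) measurable
  also have "\<dots> = - (\<integral>z. ?f z \<partial>lborel)"
    by (simp add: cn_density_def)
  finally have "(\<integral>z. ?f z \<partial>lborel) = 0" by simp
  with 1 show ?thesis by simp
qed

end

section \<open>Independence of generated sigma-algebras\<close>

context prob_space
begin

definition sigma_of :: "('i \<Rightarrow> 'a \<Rightarrow> complex) \<Rightarrow> 'i set \<Rightarrow> 'a measure" where
  "sigma_of X I = sigma (space M) (\<Union>i\<in>I. {X i -` B \<inter> space M | B. B \<in> sets borel})"

lemma space_sigma_of [simp]: "space (sigma_of X I) = space M"
  by (simp add: sigma_of_def space_measure_of_conv)

lemma sets_sigma_of:
  "sets (sigma_of X I) = sigma_sets (space M) (\<Union>i\<in>I. {X i -` B \<inter> space M | B. B \<in> sets borel})"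
  unfolding sigma_of_def by (rule sets_measure_of) auto

lemma sets_sigma_of_mono: "I \<subseteq> J \<Longrightarrow> sets (sigma_of X I) \<subseteq> sets (sigma_of X J)"
  unfolding sets_sigma_of by (rule sigma_sets_mono') blast

lemma measurable_sigma_of: "i \<in> I \<Longrightarrow> X i \<in> borel_measurable (sigma_of X I)"
  by (rule measurableI) (auto simp: sets_sigma_of intro: sigma_sets.Basic)

lemma measurable_sigma_of_mono:
  "f \<in> measurable (sigma_of X I) N \<Longrightarrow> I \<subseteq> J \<Longrightarrow> f \<in> measurable (sigma_of X J) N"
  using sets_sigma_of_mono[of I J X] by (auto simp: measurable_def)

lemma subalgebra_sigma_of:
  assumes "\<And>i. X i \<in> borel_measurable M"
  shows "subalgebra M (sigma_of X I)"
proof -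
  have "sets (sigma_of X I) \<subseteq> sets M"
    unfolding sets_sigma_of by (rule sets.sigma_sets_subset) (use assms in \<open>auto intro: measurable_sets\<close>)
  then show ?thesis by (simp add: subalgebra_def)
qed

text \<open>Grouping of independent variables: preimages of Borel sets form intersection-stable
  generators, so independence passes to the sigma-algebras generated by disjoint blocks.\<close>

lemma indep_set_sigma_of:
  assumes ind: "indep_vars (\<lambda>_. borel) X UNIV" and disj: "I \<inter> J = {}"
  shows "indep_set (sets (sigma_of X I)) (sets (sigma_of X J))"
proof -
  let ?G = "\<lambda>i. {X i -` B \<inter> space M | B. B \<in> sets (borel :: complex measure)}"
  have "indep_sets (\<lambda>j. sigma_sets (space M) (\<Union>i\<in>case_bool I J j. ?G i)) UNIV"
  proof (rule indep_sets_collect_sigma)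
    have "indep_sets ?G UNIV" using ind unfolding indep_vars_def2 by simp
    then show "indep_sets ?G (\<Union>j\<in>UNIV. case_bool I J j)"
      by (rule indep_sets_mono_index[rotated]) simp
    show "Int_stable (?G i)" for i
    proof (rule Int_stableI)
      fix a b assume "a \<in> ?G i" "b \<in> ?G i"
      then obtain A B where "a = X i -` A \<inter> space M" "b = X i -` B \<inter> space M" "A \<in> sets borel" "B \<in> sets borel"
        by blast
      then show "a \<inter> b \<in> ?G i"
        by (auto intro!: exI[of _ "A \<inter> B"])
    qed
    show "disjoint_family_on (case_bool I J) UNIV"
      using disj by (auto simp: disjoint_family_on_def split: bool.split)
  qed
  also have "(\<lambda>j. sigma_sets (space M) (\<Union>i\<in>case_bool I J j. ?G i)) = case_bool (sets (sigma_of X I)) (sets (sigma_of X J))"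
    by (auto simp: fun_eq_iff sets_sigma_of split: bool.split)
  finally show ?thesis unfolding indep_set_def .
qed

text \<open>Measurability with respect to \<open>sigma_of X I\<close> certifies that a variable
  depends only on the indices in \<open>I\<close>. Independence claims thereby reduce to
  disjointness of index sets.\<close>

lemma indep_var_sigma_of:
  assumes ind: "indep_vars (\<lambda>_. borel) X UNIV" and disj: "I \<inter> J = {}"
    and f: "f \<in> measurable (sigma_of X I) N" and g: "g \<in> measurable (sigma_of X J) N'"
  shows "indep_var N f N' g"
proof -
  have X: "X i \<in> borel_measurable M" for i
    using ind unfolding indep_vars_def2 by simp
  have sub: "sigma_sets (space M) {f -` A \<inter> space M | A. A \<in> sets N} \<subseteq> sets (sigma_of X I)"
    if f: "f \<in> measurable (sigma_of X I) N" for f N I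
    using sets.sigma_sets_subset[of "{f -` A \<inter> space M | A. A \<in> sets N}" "sigma_of X I"]
      measurable_sets[OF f] by auto
  have "indep_set (sigma_sets (space M) {f -` A \<inter> space M | A. A \<in> sets N})
      (sigma_sets (space M) {g -` A \<inter> space M | A. A \<in> sets N'})"
    using indep_set_sigma_of[OF ind disj] unfolding indep_set_def
    by (rule indep_sets_mono_sets) (use sub[OF f] sub[OF g] in \<open>auto split: bool.split\<close>)
  moreover have "f \<in> measurable M N" "g \<in> measurable M N'"
    using f g by (auto intro: measurable_from_subalg[OF subalgebra_sigma_of] X)
  ultimately show ?thesis by (simp add: indep_var_eq)
qed

end

section \<open>Square-integrable functions and growth bounds\<close>

lemma norm_sq_real_combination:
  fixes c :: "'b \<Rightarrow> complex" and v :: "'b \<Rightarrow> real"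
  shows "(cmod (\<Sum>a\<in>S. of_real (v a) * c a))\<^sup>2 = (\<Sum>a\<in>S. \<Sum>b\<in>S. v a * v b * Re (c a * cnj (c b)))"
proof -
  have "complex_of_real ((cmod (\<Sum>a\<in>S. of_real (v a) * c a))\<^sup>2) =
      (\<Sum>a\<in>S. \<Sum>b\<in>S. of_real (v a * v b) * (c a * cnj (c b)))"
    unfolding complex_norm_square cnj_sum sum_product
    by (intro sum.cong refl) (simp add: mult.assoc mult.left_commute)
  then have "Re (complex_of_real ((cmod (\<Sum>a\<in>S. of_real (v a) * c a))\<^sup>2)) =
      Re (\<Sum>a\<in>S. \<Sum>b\<in>S. of_real (v a * v b) * (c a * cnj (c b)))"
    by (rule arg_cong)
  also have "\<dots> = (\<Sum>a\<in>S. \<Sum>b\<in>S. v a * v b * Re (c a * cnj (c b)))"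
    by (simp only: Re_sum scaleR_conv_of_real[symmetric] scaleR_complex.simps)
  finally show ?thesis by simp
qed

lemma sum_option_UNIV:
  fixes f :: "'b::finite option \<Rightarrow> 'c::comm_monoid_add"
  shows "(\<Sum>a\<in>UNIV. f a) = f None + (\<Sum>j\<in>UNIV. f (Some j))"
  by (simp add: UNIV_option_conv sum.reindex)

lemma sq_sum_le_card_mult_sum_sq:
  fixes f :: "'b \<Rightarrow> real"
  shows "(\<Sum>a\<in>S. f a)\<^sup>2 \<le> real (card S) * (\<Sum>a\<in>S. (f a)\<^sup>2)"
  using Cauchy_Schwarz_ineq_sum[of "\<lambda>_. 1" f S] by simp

definition sq_integrable :: "'a measure \<Rightarrow> ('a \<Rightarrow> real) \<Rightarrow> bool" where
  "sq_integrable M f \<longleftrightarrow> f \<in> borel_measurable M \<and> integrable M (\<lambda>x. (f x)\<^sup>2)"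

lemma sq_integrable_mult: "sq_integrable M f \<Longrightarrow> sq_integrable M g \<Longrightarrow> integrable M (\<lambda>x. f x * g x)"
  by (auto simp: sq_integrable_def intro: integrable_mult_of_squares)

lemma sq_integrable_cmult: "sq_integrable M f \<Longrightarrow> sq_integrable M (\<lambda>x. c * f x)"
  by (auto simp: sq_integrable_def power_mult_distrib)

lemma sq_integrable_add: "sq_integrable M f \<Longrightarrow> sq_integrable M g \<Longrightarrow> sq_integrable M (\<lambda>x. f x + g x)"
  using sq_integrable_mult[of M f g] by (auto simp: sq_integrable_def power2_sum mult.assoc)

lemma sq_integrable_diff: "sq_integrable M f \<Longrightarrow> sq_integrable M g \<Longrightarrow> sq_integrable M (\<lambda>x. f x - g x)"
  using sq_integrable_mult[of M f g] by (auto simp: sq_integrable_def power2_diff mult.assoc)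

lemma sq_integrable_abs: "sq_integrable M f \<Longrightarrow> sq_integrable M (\<lambda>x. \<bar>f x\<bar>)"
  by (auto simp: sq_integrable_def)

lemma sq_integrable_sum: "(\<And>a. a \<in> S \<Longrightarrow> sq_integrable M (f a)) \<Longrightarrow> sq_integrable M (\<lambda>x. \<Sum>a\<in>S. f a x)"
  by (induction S rule: infinite_finite_induct) (auto simp: sq_integrable_add, auto simp: sq_integrable_def)

lemma (in prob_space) sq_integrable_const: "sq_integrable M (\<lambda>_. c)"
  by (simp add: sq_integrable_def)

lemma (in prob_space) sq_integrable_integrable: "sq_integrable M f \<Longrightarrow> integrable M f"
  using sq_integrable_mult[OF _ sq_integrable_const[of 1], of f] by simp

text \<open>A discrete Gronwall estimate, from \<open>1 + e k \<le> exp (e k)\<close>.\<close>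

lemma multiplicative_growth_bounded:
  fixes w e :: "nat \<Rightarrow> real"
  assumes w: "\<And>k. 0 \<le> w k" and e: "\<And>k. 0 \<le> e k" "summable e"
    and step: "\<And>k. w (Suc k) \<le> (1 + e k) * w k"
  shows "w k \<le> w 0 * exp (suminf e)"
proof -
  have "w k \<le> w 0 * exp (\<Sum>i<k. e i)"
  proof (induction k)
    case (Suc k)
    have "w (Suc k) \<le> exp (e k) * w k"
      using step[of k] mult_right_mono[OF exp_ge_add_one_self[of "e k"] w[of k]] by simp
    also have "\<dots> \<le> exp (e k) * (w 0 * exp (\<Sum>i<k. e i))"
      using Suc by simp
    finally show ?case by (simp add: exp_add mult_ac)
  qed simp
  also have "\<dots> \<le> w 0 * exp (suminf e)"
    using e w[of 0] by (intro mult_left_mono) (simp_all add: sum_le_suminf)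
  finally show ?thesis .
qed

text \<open>By Tonelli the sum has finite expectation, so it is finite almost everywhere.\<close>

lemma (in prob_space) AE_summable_of_summable_integral:
  fixes f :: "nat \<Rightarrow> 'a \<Rightarrow> real"
  assumes f: "\<And>k. integrable M (f k)" "\<And>k \<omega>. 0 \<le> f k \<omega>"
    and sum: "summable (\<lambda>k. \<integral>\<omega>. f k \<omega> \<partial>M)"
  shows "AE \<omega> in M. summable (\<lambda>k. f k \<omega>)"
proof -
  have [measurable]: "f k \<in> borel_measurable M" for k using f(1) by auto
  have "(\<integral>\<^sup>+\<omega>. (\<Sum>k. ennreal (f k \<omega>)) \<partial>M) = (\<Sum>k. \<integral>\<^sup>+\<omega>. ennreal (f k \<omega>) \<partial>M)"
    by (rule nn_integral_suminf) measurable
  also have "\<dots> = (\<Sum>k. ennreal (\<integral>\<omega>. f k \<omega> \<partial>M))"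
    using f by (simp add: nn_integral_eq_integral)
  also have "\<dots> = ennreal (\<Sum>k. \<integral>\<omega>. f k \<omega> \<partial>M)"
    using f sum by (intro suminf_ennreal2) auto
  finally have "(\<integral>\<^sup>+\<omega>. (\<Sum>k. ennreal (f k \<omega>)) \<partial>M) \<noteq> \<infinity>" by simp
  then have "AE \<omega> in M. (\<Sum>k. ennreal (f k \<omega>)) \<noteq> \<infinity>"
    by (intro nn_integral_PInf_AE) measurable
  then show ?thesis
    by eventually_elim (use f(2) in \<open>auto intro: summable_suminf_not_top\<close>)
qed

section \<open>The over-the-air protocol\<close>

primrec time_of :: "'v oac_idx \<Rightarrow> nat" where
  "time_of (Gam i k) = k"
| "time_of (Chan i j k) = k"
| "time_of (Noi i k) = k"

locale over_the_air_consensus = prob_space M for M :: "'m measure" +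
  fixes E :: "'v::finite \<Rightarrow> 'v \<Rightarrow> bool"
    and x0 :: "'v \<Rightarrow> real"
    and \<rho> :: real and u :: complex
    and p :: "'v \<Rightarrow> real" and \<Lambda> :: "'v \<Rightarrow> 'v \<Rightarrow> real" and \<sigma> :: "'v \<Rightarrow> real"
    and \<alpha> :: "nat \<Rightarrow> real"
    and \<gamma> :: "'v \<Rightarrow> nat \<Rightarrow> 'm \<Rightarrow> bool"
    and h :: "'v \<Rightarrow> 'v \<Rightarrow> nat \<Rightarrow> 'm \<Rightarrow> complex"
    and n :: "'v \<Rightarrow> nat \<Rightarrow> 'm \<Rightarrow> complex"
  assumes E_sym: "\<And>i j. E i j \<longleftrightarrow> E j i"
    and E_irrefl: "\<And>i. \<not> E i i"
    and E_conn: "\<And>i j. E\<^sup>*\<^sup>* i j"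
    and \<rho>: "\<rho> > 0"
    and u: "cmod u = 1"
    and p: "\<And>i. 0 < p i \<and> p i < 1"
    and \<Lambda>_sym: "\<And>i j. \<Lambda> i j = \<Lambda> j i"
    and \<Lambda>_pos: "\<And>i j. \<Lambda> i j > 0"
    and \<sigma>_pos: "\<And>i. \<sigma> i > 0"
    and \<gamma>_meas: "\<And>i k. \<gamma> i k \<in> measurable M (count_space UNIV)"
    and \<gamma>_dist: "\<And>i k. measure M {\<omega> \<in> space M. \<gamma> i k \<omega>} = p i"
    and h_dist: "\<And>i j k. distributed M lborel (h i j k) (\<lambda>z. ennreal (cn_density (\<Lambda> i j) z))"
    and n_dist: "\<And>i k. distributed M lborel (n i k) (\<lambda>z. ennreal (cn_density ((\<sigma> i)\<^sup>2) z))"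
    and indep: "indep_vars (\<lambda>_. borel) (oac_family \<gamma> h n) UNIV"
    and \<alpha>_pos: "\<And>k. \<alpha> k > 0"
    and \<alpha>_div: "\<not> summable \<alpha>"
    and \<alpha>_sq: "summable (\<lambda>k. (\<alpha> k)\<^sup>2)"
begin

section \<open>Edge weights and the filtration of the protocol\<close>

abbreviation A :: "'v \<Rightarrow> 'v \<Rightarrow> real" where "A \<equiv> abar \<rho> E p \<Lambda>"
abbreviation X :: "'v oac_idx \<Rightarrow> 'm \<Rightarrow> complex" where "X \<equiv> oac_family \<gamma> h n"
abbreviation q :: "'v \<Rightarrow> 'v \<Rightarrow> real" where "q i j \<equiv> p i * (1 - p j) + p j * (1 - p i)"

text \<open>The inequality is strict because the state at time \<open>k\<close> is determined by the
  variables of earlier times; those of time \<open>k\<close> drive the transition to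
  \<open>Suc k\<close>.\<close>

definition past :: "nat \<Rightarrow> 'm measure" where "past k = sigma_of X {\<iota>. time_of \<iota> < k}"
definition present :: "nat \<Rightarrow> 'm measure" where "present k = sigma_of X {\<iota>. time_of \<iota> = k}"

lemma q_pos: "0 < q i j"
  using p[of i] p[of j] by (intro add_pos_pos mult_pos_pos) auto

lemma A_sym: "A i j = A j i"
  using E_sym[of i j] \<Lambda>_sym[of i j] by (simp add: abar_def algebra_simps)

lemma A_pos: "E i j \<Longrightarrow> 0 < A i j"
  using \<rho> q_pos[of i j] \<Lambda>_pos[of i j] by (simp add: abar_def)

lemma A_nonneg: "0 \<le> A i j"
  using A_pos[of i j] by (cases "E i j") (auto simp: abar_def)

lemma X_measurable: "X \<iota> \<in> borel_measurable M"
  using indep unfolding indep_vars_def2 by simp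

lemma subalgebra_past: "subalgebra M (past k)"
  unfolding past_def by (rule subalgebra_sigma_of[OF X_measurable])

lemma subalgebra_present: "subalgebra M (present k)"
  unfolding present_def by (rule subalgebra_sigma_of[OF X_measurable])

lemma past_mono: "k \<le> l \<Longrightarrow> sets (past k) \<subseteq> sets (past l)"
  unfolding past_def by (rule sets_sigma_of_mono) auto

lemma measurable_past_Suc:
  "f \<in> measurable (past k) N \<Longrightarrow> f \<in> measurable (past (Suc k)) N"
  "f \<in> measurable (present k) N \<Longrightarrow> f \<in> measurable (past (Suc k)) N"
  unfolding past_def present_def by (auto elim!: measurable_sigma_of_mono)

lemma indep_past_present:
  "f \<in> measurable (past k) N \<Longrightarrow> g \<in> measurable (present k) N' \<Longrightarrow> indep_var N f N' g"
  unfolding past_def present_def by (rule indep_var_sigma_of[OF indep]) auto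

text \<open>A product of two square-integrable functions is in general only integrable; here the
  squares are independent, so the product stays square-integrable and its second moment
  factorizes.\<close>

lemma past_present_mult:
  assumes f: "f \<in> borel_measurable (past k)" "sq_integrable M f"
    and g: "g \<in> borel_measurable (present k)" "sq_integrable M g"
  shows "sq_integrable M (\<lambda>\<omega>. f \<omega> * g \<omega>)"
    and "(\<integral>\<omega>. (f \<omega> * g \<omega>)\<^sup>2 \<partial>M) = (\<integral>\<omega>. (f \<omega>)\<^sup>2 \<partial>M) * (\<integral>\<omega>. (g \<omega>)\<^sup>2 \<partial>M)"
proof -
  have i: "indep_var borel (\<lambda>\<omega>. (f \<omega>)\<^sup>2) borel (\<lambda>\<omega>. (g \<omega>)\<^sup>2)"
    using f g by (intro indep_past_present[of _ k]) auto
  show "(\<integral>\<omega>. (f \<omega> * g \<omega>)\<^sup>2 \<partial>M) = (\<integral>\<omega>. (f \<omega>)\<^sup>2 \<partial>M) * (\<integral>\<omega>. (g \<omega>)\<^sup>2 \<partial>M)"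
    using indep_var_lebesgue_integral[OF i] f g by (simp add: sq_integrable_def power_mult_distrib)
  show "sq_integrable M (\<lambda>\<omega>. f \<omega> * g \<omega>)"
    unfolding sq_integrable_def
  proof
    show "(\<lambda>\<omega>. f \<omega> * g \<omega>) \<in> borel_measurable M"
      using f(2) g(2) unfolding sq_integrable_def by (intro borel_measurable_times) auto
    show "integrable M (\<lambda>\<omega>. (f \<omega> * g \<omega>)\<^sup>2)"
      using indep_var_integrable[OF i] f g by (simp add: sq_integrable_def power_mult_distrib)
  qed
qed

text \<open>The received signal is a real combination, with coefficients known from the past, of the
  fading coefficients \<open>link k i (Some j)\<close> of the links and the noise \<open>link k i None\<close>.\<close>

definition src :: "nat \<Rightarrow> 'v \<Rightarrow> 'v option \<Rightarrow> 'v oac_idx" where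
  "src k i a = (case a of None \<Rightarrow> Noi i k | Some j \<Rightarrow> Chan i j k)"

definition src_var :: "'v \<Rightarrow> 'v option \<Rightarrow> real" where
  "src_var i a = (case a of None \<Rightarrow> (\<sigma> i)\<^sup>2 | Some j \<Rightarrow> \<Lambda> i j)"

text \<open>For 0/1 bits the squared difference is the exclusive or. Written as a polynomial in the
  primitive variables, it is visibly measurable for every sigma-algebra that contains the
  bits.\<close>

definition gate :: "nat \<Rightarrow> 'v \<Rightarrow> 'v option \<Rightarrow> 'm \<Rightarrow> complex" where
  "gate k i a \<omega> = (case a of None \<Rightarrow> 1 | Some j \<Rightarrow>
     if E i j then of_real ((Re (X (Gam i k) \<omega>) - Re (X (Gam j k) \<omega>))\<^sup>2) * u else 0)"

definition link :: "nat \<Rightarrow> 'v \<Rightarrow> 'v option \<Rightarrow> 'm \<Rightarrow> complex" where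
  "link k i a \<omega> = gate k i a \<omega> * X (src k i a) \<omega>"

definition link_var :: "'v \<Rightarrow> 'v option \<Rightarrow> real" where
  "link_var i a = (case a of None \<Rightarrow> (\<sigma> i)\<^sup>2 | Some j \<Rightarrow> if E i j then q i j * \<Lambda> i j else 0)"

lemma src_distributed: "distributed M lborel (X (src k i a)) (\<lambda>z. ennreal (cn_density (src_var i a) z))"
  using h_dist n_dist by (simp add: src_def src_var_def split: option.split)

lemma src_var_pos: "0 < src_var i a"
  using \<Lambda>_pos \<sigma>_pos[of i] by (simp add: src_var_def split: option.split)

lemma time_of_src [simp]: "time_of (src k i a) = k"
  by (simp add: src_def split: option.split)

lemma src_eq_iff [simp]: "src k i a = src k i b \<longleftrightarrow> a = b"
  by (auto simp: src_def split: option.split)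

lemma gate_measurable:
  assumes "\<And>j. Gam j k \<in> I"
  shows "gate k i a \<in> borel_measurable (sigma_of X I)"
proof -
  have [measurable]: "X (Gam j k) \<in> borel_measurable (sigma_of X I)" for j
    by (rule measurable_sigma_of[OF assms])
  show ?thesis unfolding gate_def by (cases a) simp_all
qed

lemma gate_src_neq: "Gam j k \<in> - {src k i a}"
  by (simp add: src_def split: option.split)

lemma gate_le_1: "cmod (gate k i a \<omega>) \<le> 1"
  by (auto simp: gate_def norm_mult u split: option.split)

lemma link_present: "link k i a \<in> borel_measurable (present k)"
  unfolding link_def present_def
  by (intro borel_measurable_times gate_measurable measurable_sigma_of) auto

lemma link_le: "cmod (link k i a \<omega>) \<le> cmod (X (src k i a) \<omega>)"
  using mult_right_mono[OF gate_le_1, of "cmod (X (src k i a) \<omega>)"] by (simp add: link_def norm_mult)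

lemma src_integrable: "integrable M (X (src k i a))"
proof -
  have "sq_integrable M (\<lambda>\<omega>. cmod (X (src k i a) \<omega>))"
    using cn_norm_sq[OF src_var_pos[of i a] src_distributed[of k i a]] X_measurable
    by (auto simp: sq_integrable_def has_bochner_integral_iff)
  then have "integrable M (\<lambda>\<omega>. cmod (X (src k i a) \<omega>))" by (rule sq_integrable_integrable)
  then show ?thesis using X_measurable by (simp add: integrable_norm_iff)
qed

text \<open>Links into the same agent may share the bit of that agent, so in general they are only
  uncorrelated, not independent. The centred Gaussian factor of \<open>a\<close> is independent of
  everything else in the product, both gates included.\<close>

lemma link_orthogonal:
  assumes a: "a \<noteq> b"
  shows "(\<integral>\<omega>. link k i a \<omega> * cnj (link k i b \<omega>) \<partial>M) = 0"
proof -
  let ?J = "- {src k i a}"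
  define rest where "rest \<omega> = gate k i a \<omega> * cnj (link k i b \<omega>)" for \<omega>
  have rest: "rest \<in> borel_measurable (sigma_of X ?J)"
  proof -
    have [measurable]: "gate k i d \<in> borel_measurable (sigma_of X ?J)" for d
      by (intro gate_measurable gate_src_neq)
    have [measurable]: "X (src k i b) \<in> borel_measurable (sigma_of X ?J)"
      using a by (intro measurable_sigma_of) auto
    have [measurable]: "cnj \<in> borel_measurable borel"
      by (intro borel_measurable_continuous_onI continuous_intros)
    show ?thesis unfolding rest_def link_def by measurable
  qed
  have "rest \<in> borel_measurable M"
    using rest by (rule measurable_from_subalg[OF subalgebra_sigma_of[OF X_measurable]])
  moreover have "cmod (rest \<omega>) \<le> cmod (X (src k i b) \<omega>)" for \<omega>
    using mult_mono[OF gate_le_1[of k i a \<omega>] link_le[of k i b \<omega>]] by (simp add: rest_def norm_mult)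
  ultimately have int: "integrable M rest"
    by (intro Bochner_Integration.integrable_bound[OF src_integrable[of k i b]]) auto
  have "indep_var borel (X (src k i a)) borel rest"
    by (rule indep_var_sigma_of[OF indep, of "{src k i a}" ?J]) (auto intro: measurable_sigma_of rest)
  then have "(\<integral>\<omega>. X (src k i a) \<omega> * rest \<omega> \<partial>M) = (\<integral>\<omega>. X (src k i a) \<omega> \<partial>M) * (\<integral>\<omega>. rest \<omega> \<partial>M)"
    using src_integrable int by (rule indep_var_lebesgue_integral)
  also have "\<dots> = 0"
    using cn_mean_zero[OF src_var_pos[of i a] src_distributed[of k i a]] by simp
  finally show ?thesis by (simp add: rest_def link_def mult_ac)
qed

lemma gate_norm_sq: "(\<integral>\<omega>. (cmod (gate k i a \<omega>))\<^sup>2 \<partial>M) = (case a of None \<Rightarrow> 1 | Some j \<Rightarrow> if E i j then q i j else 0)"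
proof (cases "\<exists>j. a = Some j \<and> E i j")
  case False
  then show ?thesis by (auto simp: gate_def prob_space split: option.split)
next
  case True
  then obtain j where a: "a = Some j" "E i j" by blast
  \<comment> \<open>Absence of self-loops makes the two bits distinct members of the independent
    family.\<close>
  then have ij: "i \<noteq> j" using E_irrefl by blast
  let ?g = "\<lambda>i \<omega>. Re (X (Gam i k) \<omega>)"
  have g: "?g i = indicator {\<omega>. \<gamma> i k \<omega>}" for i by (auto simp: fun_eq_iff)
  have gm [measurable]: "?g i \<in> borel_measurable M" for i
    using X_measurable[of "Gam i k"] by measurable
  have gi: "integrable M (?g i)" for i
    by (rule integrable_const_bound[of _ 1]) (auto simp del: oac_family.simps intro: gm, simp)
  have Eg: "(\<integral>\<omega>. ?g i \<omega> \<partial>M) = p i" for i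
  proof -
    have "(\<integral>\<omega>. ?g i \<omega> \<partial>M) = (\<integral>\<omega>. indicator {\<omega> \<in> space M. \<gamma> i k \<omega>} \<omega> \<partial>M)"
      by (intro Bochner_Integration.integral_cong) (auto simp: g)
    also have "\<dots> = p i" using \<gamma>_meas[of i k] by (simp add: \<gamma>_dist)
    finally show ?thesis .
  qed
  have [measurable]: "X \<iota> \<in> borel_measurable (sigma_of X {\<iota>})" for \<iota> by (rule measurable_sigma_of) simp
  have iv: "indep_var borel (?g i) borel (?g j)"
    by (rule indep_var_sigma_of[OF indep, of "{Gam i k}" "{Gam j k}"]) (use ij in simp, measurable)
  have "(cmod (gate k i a \<omega>))\<^sup>2 = ?g i \<omega> + ?g j \<omega> - 2 * (?g i \<omega> * ?g j \<omega>)" for \<omega>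
    using a by (simp add: gate_def norm_mult u)
  then have "(\<integral>\<omega>. (cmod (gate k i a \<omega>))\<^sup>2 \<partial>M) = p i + p j - 2 * (p i * p j)"
    using gi indep_var_integrable[OF iv gi gi] indep_var_lebesgue_integral[OF iv gi gi]
    by (simp add: Eg del: oac_family.simps)
  with a show ?thesis by (simp add: algebra_simps)
qed

lemma link_norm_sq: "(\<integral>\<omega>. (cmod (link k i a \<omega>))\<^sup>2 \<partial>M) = link_var i a"
proof -
  have [measurable]: "gate k i a \<in> borel_measurable (sigma_of X (- {src k i a}))"
    by (intro gate_measurable gate_src_neq)
  have [measurable]: "X (src k i a) \<in> borel_measurable (sigma_of X {src k i a})"
    by (rule measurable_sigma_of) simp
  have iv: "indep_var borel (\<lambda>\<omega>. (cmod (gate k i a \<omega>))\<^sup>2) borel (\<lambda>\<omega>. (cmod (X (src k i a) \<omega>))\<^sup>2)"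
    by (rule indep_var_sigma_of[OF indep, of "- {src k i a}" "{src k i a}"]) (simp, measurable)
  have "gate k i a \<in> borel_measurable M"
    by (rule measurable_from_subalg[OF subalgebra_sigma_of[of X UNIV, OF X_measurable]]) (simp add: gate_measurable)
  then have "integrable M (\<lambda>\<omega>. (cmod (gate k i a \<omega>))\<^sup>2)"
    by (intro integrable_const_bound[of _ 1]) (auto simp: gate_le_1 power_le_one)
  with cn_norm_sq[OF src_var_pos[of i a] src_distributed[of k i a]]
  have "(\<integral>\<omega>. (cmod (gate k i a \<omega>))\<^sup>2 * (cmod (X (src k i a) \<omega>))\<^sup>2 \<partial>M) =
      (\<integral>\<omega>. (cmod (gate k i a \<omega>))\<^sup>2 \<partial>M) * src_var i a"
    by (subst indep_var_lebesgue_integral[OF iv]) (auto simp: has_bochner_integral_iff)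
  then show ?thesis
    unfolding gate_norm_sq link_def norm_mult power_mult_distrib
    by (simp add: link_var_def src_var_def split: option.split)
qed

section \<open>Moments of the centred quadratic terms\<close>

text \<open>Only the diagonal is centred, since off-diagonal products already have mean zero by
  \<open>link_orthogonal\<close>.\<close>

definition fluct :: "nat \<Rightarrow> 'v \<Rightarrow> 'v option \<Rightarrow> 'v option \<Rightarrow> 'm \<Rightarrow> real" where
  "fluct k i a b \<omega> = Re (link k i a \<omega> * cnj (link k i b \<omega>)) - (if a = b then link_var i a else 0)"

text \<open>A sum in place of a maximum gives one constant for all agents and links; the factor 3 is
  that of \<open>cn_fourth_moment\<close>.\<close>

definition fourth_bound :: real where
  "fourth_bound = (\<Sum>i\<in>UNIV. \<Sum>a\<in>UNIV. 3 * (src_var i a)\<^sup>2)"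

lemma fourth_bound_ge: "3 * (src_var i a)\<^sup>2 \<le> fourth_bound"
proof -
  have "3 * (src_var i a)\<^sup>2 \<le> (\<Sum>a\<in>UNIV. 3 * (src_var i a)\<^sup>2)"
    by (rule member_le_sum) auto
  also have "\<dots> \<le> fourth_bound"
    unfolding fourth_bound_def by (rule member_le_sum) (auto intro: sum_nonneg)
  finally show ?thesis .
qed

lemma fluct_present: "fluct k i a b \<in> borel_measurable (present k)"
proof -
  have [measurable]: "link k i a \<in> borel_measurable (present k)" for a by (rule link_present)
  have [measurable]: "cnj \<in> borel_measurable borel"
    by (intro borel_measurable_continuous_onI continuous_intros)
  show ?thesis unfolding fluct_def by measurable
qed

text \<open>Gates have modulus at most 1, so each product is dominated by Gaussian factors alone;
  \<open>2 * x * y \<le> x\<^sup>2 + y\<^sup>2\<close> then separates them into fourth moments, and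
  centring only lowers the second moment.\<close>

lemma fluct_moments:
  shows "sq_integrable M (fluct k i a b)" and "(\<integral>\<omega>. fluct k i a b \<omega> \<partial>M) = 0" and "(\<integral>\<omega>. (fluct k i a b \<omega>)\<^sup>2 \<partial>M) \<le> fourth_bound"
proof -
  let ?r = "\<lambda>\<omega>. Re (link k i a \<omega> * cnj (link k i b \<omega>))"
  let ?m = "if a = b then link_var i a else 0"
  let ?B = "\<lambda>\<omega>. ((cmod (X (src k i a) \<omega>)) ^ 4 + (cmod (X (src k i b) \<omega>)) ^ 4) / 2"
  have cM: "link k i d \<in> borel_measurable M" for d
    using link_present by (rule measurable_from_subalg[OF subalgebra_present])
  have cnjM: "cnj \<in> borel_measurable borel"
    by (intro borel_measurable_continuous_onI continuous_intros)
  have pM: "(\<lambda>\<omega>. link k i a \<omega> * cnj (link k i b \<omega>)) \<in> borel_measurable M"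
    using cM[of a] measurable_compose[OF cM[of b] cnjM] by (rule borel_measurable_times)
  then have rM: "?r \<in> borel_measurable M" by measurable
  have le: "(cmod (link k i a \<omega> * cnj (link k i b \<omega>)))\<^sup>2 \<le> ?B \<omega>" for \<omega>
  proof -
    let ?a = "cmod (X (src k i a) \<omega>)" and ?b = "cmod (X (src k i b) \<omega>)"
    have "cmod (link k i a \<omega> * cnj (link k i b \<omega>)) \<le> ?a * ?b"
      using mult_mono[OF link_le[of k i a \<omega>] link_le[of k i b \<omega>]] by (simp add: norm_mult)
    then have "(cmod (link k i a \<omega> * cnj (link k i b \<omega>)))\<^sup>2 \<le> (?a * ?b)\<^sup>2"
      by (rule power_mono) simp
    also have "\<dots> \<le> ((?a\<^sup>2)\<^sup>2 + (?b\<^sup>2)\<^sup>2) / 2"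
      using sum_squares_bound[of "?a\<^sup>2" "?b\<^sup>2"] by (simp add: power_mult_distrib)
    finally show ?thesis by (simp add: power_mult[symmetric])
  qed
  have B: "integrable M ?B" "(\<integral>\<omega>. ?B \<omega> \<partial>M) \<le> fourth_bound"
    using cn_fourth_moment[OF src_var_pos[of i a] src_distributed[of k i a]] fourth_bound_ge[of i a]
      cn_fourth_moment[OF src_var_pos[of i b] src_distributed[of k i b]] fourth_bound_ge[of i b] by simp_all
  have rle: "(?r \<omega>)\<^sup>2 \<le> ?B \<omega>" for \<omega>
  proof -
    have "\<bar>?r \<omega>\<bar>\<^sup>2 \<le> (cmod (link k i a \<omega> * cnj (link k i b \<omega>)))\<^sup>2"
      by (intro power_mono abs_Re_le_cmod) simp
    with le[of \<omega>] show ?thesis by simp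
  qed
  have r2: "integrable M (\<lambda>\<omega>. (?r \<omega>)\<^sup>2)"
    by (rule Bochner_Integration.integrable_bound[OF B(1)])
      (use rM rle in \<open>auto intro!: AE_I2 order_trans[OF _ abs_ge_self] simp del: times_complex.simps\<close>)
  then have r: "sq_integrable M ?r" using rM by (simp add: sq_integrable_def)
  then show sq: "sq_integrable M (fluct k i a b)"
    unfolding fluct_def by (intro sq_integrable_diff sq_integrable_const)
  have p_int: "integrable M (\<lambda>\<omega>. link k i a \<omega> * cnj (link k i b \<omega>))"
  proof -
    have "sq_integrable M (\<lambda>\<omega>. cmod (link k i a \<omega> * cnj (link k i b \<omega>)))"
      unfolding sq_integrable_def using pM le
      by (intro conjI Bochner_Integration.integrable_bound[OF B(1)])
        (auto simp del: norm_mult intro!: AE_I2 order_trans[OF _ abs_ge_self])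
    then show ?thesis using pM sq_integrable_integrable integrable_norm_iff by blast
  qed
  have Er: "(\<integral>\<omega>. ?r \<omega> \<partial>M) = ?m"
  proof (cases "a = b")
    case True
    then have "?r \<omega> = (cmod (link k i a \<omega>))\<^sup>2" for \<omega>
      using complex_norm_square[of "link k i a \<omega>"] by (metis Re_complex_of_real)
    then show ?thesis using True by (simp only: link_norm_sq) simp
  next
    case False
    have "(\<integral>\<omega>. ?r \<omega> \<partial>M) = Re (\<integral>\<omega>. link k i a \<omega> * cnj (link k i b \<omega>) \<partial>M)"
      by (rule integral_Re[OF p_int])
    with False show ?thesis by (simp add: link_orthogonal)
  qed
  then show "(\<integral>\<omega>. fluct k i a b \<omega> \<partial>M) = 0"
    unfolding fluct_def using sq_integrable_integrable[OF r] by (simp add: prob_space del: times_complex.simps)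
  have "(\<integral>\<omega>. (fluct k i a b \<omega>)\<^sup>2 \<partial>M) = (\<integral>\<omega>. (?r \<omega>)\<^sup>2 - 2 * ?m * ?r \<omega> + ?m\<^sup>2 \<partial>M)"
    unfolding fluct_def by (intro Bochner_Integration.integral_cong refl) (simp only: power2_diff mult_ac)
  also have "\<dots> = (\<integral>\<omega>. (?r \<omega>)\<^sup>2 \<partial>M) - ?m\<^sup>2"
    using r2 sq_integrable_integrable[OF r] Er
    by (simp add: prob_space power2_eq_square del: times_complex.simps)
  also have "\<dots> \<le> (\<integral>\<omega>. (?r \<omega>)\<^sup>2 \<partial>M)" by simp
  also have "\<dots> \<le> (\<integral>\<omega>. ?B \<omega> \<partial>M)"
    by (rule integral_mono[OF r2 B(1) rle])
  finally show "(\<integral>\<omega>. (fluct k i a b \<omega>)\<^sup>2 \<partial>M) \<le> fourth_bound" using B(2) by linarith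
qed

section \<open>Splitting the update into drift and noise\<close>

definition state :: "nat \<Rightarrow> 'v \<Rightarrow> 'm \<Rightarrow> real" where
  "state k i \<omega> = oac_state \<rho> u E p \<Lambda> \<sigma> \<alpha> x0 \<gamma> h n k i \<omega>"

text \<open>The value 1 at \<open>None\<close> lets the receiver noise be treated as one more link
  of constant amplitude.\<close>

definition amp :: "nat \<Rightarrow> 'v option \<Rightarrow> 'm \<Rightarrow> real" where
  "amp k a \<omega> = (case a of None \<Rightarrow> 1 | Some j \<Rightarrow> sqrt (\<rho> * state k j \<omega>))"

definition \<xi> :: "nat \<Rightarrow> 'v \<Rightarrow> 'm \<Rightarrow> real" where
  "\<xi> k i \<omega> = (\<Sum>a\<in>UNIV. \<Sum>b\<in>UNIV. amp k a \<omega> * amp k b \<omega> * fluct k i a b \<omega>)"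

text \<open>States may be negative and \<open>sqrt\<close> is odd on the reals, so the conditional mean of the
  received power involves \<open>\<bar>state k j \<omega>\<bar>\<close>.\<close>
definition drift :: "nat \<Rightarrow> 'v \<Rightarrow> 'm \<Rightarrow> real" where
  "drift k i \<omega> = (\<Sum>j\<in>UNIV. A i j * (\<bar>state k j \<omega>\<bar> - state k i \<omega>))"

definition energy :: "nat \<Rightarrow> 'm \<Rightarrow> real" where
  "energy k \<omega> = (\<Sum>i\<in>UNIV. (state k i \<omega>)\<^sup>2)"

lemma rx_signal_eq:
  "rx_signal \<rho> u E \<gamma> h n (oac_state \<rho> u E p \<Lambda> \<sigma> \<alpha> x0 \<gamma> h n k) k i \<omega> = (\<Sum>a\<in>UNIV. of_real (amp k a \<omega>) * link k i a \<omega>)"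
proof -
  have "(\<Sum>j\<in>{j. E i j}. complex_of_real (Gam_ij \<gamma> i j k \<omega>) * h i j k \<omega> *
        complex_of_real (sqrt (\<rho> * oac_state \<rho> u E p \<Lambda> \<sigma> \<alpha> x0 \<gamma> h n k j \<omega>)) * u) =
      (\<Sum>j\<in>UNIV. of_real (amp k (Some j) \<omega>) * link k i (Some j) \<omega>)"
    by (rule sum.mono_neutral_cong_left)
      (auto simp: link_def gate_def src_def amp_def state_def Gam_ij_def)
  then show ?thesis
    by (simp add: rx_signal_def sum_option_UNIV) (simp add: link_def gate_def src_def amp_def)
qed

lemma state_0: "state 0 i \<omega> = x0 i"
  by (simp add: state_def)

text \<open>Expanding the received power over pairs of links leaves, besides \<xi>, only diagonal
  means. The one of \<open>None\<close> cancels the subtracted noise variance; the one of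
  \<open>Some j\<close> is \<open>A i j\<close> times the absolute state, as the squared real root
  of a negative number is its absolute value.\<close>

lemma state_Suc: "state (Suc k) i \<omega> = state k i \<omega> + \<alpha> k * drift k i \<omega> + \<alpha> k * \<xi> k i \<omega>"
proof -
  have "(cmod (rx_signal \<rho> u E \<gamma> h n (oac_state \<rho> u E p \<Lambda> \<sigma> \<alpha> x0 \<gamma> h n k) k i \<omega>))\<^sup>2 =
      (\<Sum>a\<in>UNIV. \<Sum>b\<in>UNIV. amp k a \<omega> * amp k b \<omega> * Re (link k i a \<omega> * cnj (link k i b \<omega>)))"
    unfolding rx_signal_eq by (rule norm_sq_real_combination)
  also have "\<dots> = \<xi> k i \<omega> + (\<Sum>a\<in>UNIV. \<Sum>b\<in>UNIV. if a = b then amp k a \<omega> * amp k b \<omega> * link_var i a else 0)"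
    unfolding \<xi>_def fluct_def sum.distrib[symmetric] by (intro sum.cong refl) (simp add: right_diff_distrib del: times_complex.simps)
  also have "(\<Sum>a\<in>UNIV. \<Sum>b\<in>UNIV. if a = b then amp k a \<omega> * amp k b \<omega> * link_var i a else 0) = (\<Sum>a\<in>UNIV. amp k a \<omega> * amp k a \<omega> * link_var i a)"
    by simp
  also have "\<dots> = (\<sigma> i)\<^sup>2 + (\<Sum>j\<in>UNIV. A i j * \<bar>state k j \<omega>\<bar>)"
    unfolding sum_option_UNIV using \<rho>
    by (auto simp: amp_def link_var_def abar_def abs_mult intro!: sum.cong)
  finally have "(cmod (rx_signal \<rho> u E \<gamma> h n (oac_state \<rho> u E p \<Lambda> \<sigma> \<alpha> x0 \<gamma> h n k) k i \<omega>))\<^sup>2 - (\<sigma> i)\<^sup>2 =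
      \<xi> k i \<omega> + (\<Sum>j\<in>UNIV. A i j * \<bar>state k j \<omega>\<bar>)" by simp
  then have "state (Suc k) i \<omega> = (1 - \<alpha> k * (\<Sum>j\<in>UNIV. A i j)) * state k i \<omega> + \<alpha> k * (\<xi> k i \<omega> + (\<Sum>j\<in>UNIV. A i j * \<bar>state k j \<omega>\<bar>))"
    by (simp only: state_def oac_state.simps)
  then show ?thesis
    by (simp add: drift_def right_diff_distrib sum_subtractf sum_distrib_right left_diff_distrib distrib_left)
qed

lemma amp_fourth_le: "(amp k a \<omega>) ^ 4 \<le> 1 + \<rho>\<^sup>2 * energy k \<omega>"
proof (cases a)
  case None
  then show ?thesis by (simp add: amp_def energy_def sum_nonneg)
next
  case (Some j)
  have "z ^ 4 = (z * z)\<^sup>2" for z :: real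
    by (simp add: power2_eq_square power4_eq_xxxx)
  then have "(sqrt (\<rho> * state k j \<omega>)) ^ 4 = (sqrt (\<rho> * state k j \<omega>) * sqrt (\<rho> * state k j \<omega>))\<^sup>2" .
  also have "\<dots> = \<rho>\<^sup>2 * (state k j \<omega>)\<^sup>2" by (simp add: power_mult_distrib)
  also have "\<dots> \<le> \<rho>\<^sup>2 * energy k \<omega>"
    unfolding energy_def by (intro mult_left_mono member_le_sum[where f = "\<lambda>i. (state k i \<omega>)\<^sup>2"]) auto
  finally show ?thesis using Some by (simp add: amp_def)
qed

lemma amp2_sq_le: "(amp k a \<omega> * amp k b \<omega>)\<^sup>2 \<le> 1 + \<rho>\<^sup>2 * energy k \<omega>"
proof -
  have "(amp k a \<omega> * amp k b \<omega>)\<^sup>2 \<le> ((amp k a \<omega>) ^ 4 + (amp k b \<omega>) ^ 4) / 2"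
    using sum_squares_bound[of "(amp k a \<omega>)\<^sup>2" "(amp k b \<omega>)\<^sup>2"] by (simp add: power_mult_distrib power_mult[symmetric])
  with amp_fourth_le[of k a \<omega>] amp_fourth_le[of k b \<omega>] show ?thesis by simp
qed

lemma past_measurable_M: "f \<in> borel_measurable (past k) \<Longrightarrow> f \<in> borel_measurable M"
  by (rule measurable_from_subalg[OF subalgebra_past])

text \<open>Both facts about the states are assumed at a single time \<open>k\<close>, since the
  induction in \<open>state_adapted\<close> that establishes them uses the consequences drawn
  here.\<close>

context
  fixes k
  assumes state_past: "\<And>i. state k i \<in> borel_measurable (past k)"
    and state_sq: "\<And>i. sq_integrable M (state k i)"
begin

lemma energy_integrable: "integrable M (energy k)"
  unfolding energy_def using state_sq by (auto simp: sq_integrable_def)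

lemma amp_past: "amp k a \<in> borel_measurable (past k)"
  unfolding amp_def using state_past by (cases a) auto

lemma amp2_past: "(\<lambda>\<omega>. amp k a \<omega> * amp k b \<omega>) \<in> borel_measurable (past k)"
  by (intro borel_measurable_times amp_past)

lemma amp2_sq: "sq_integrable M (\<lambda>\<omega>. amp k a \<omega> * amp k b \<omega>)"
  and amp2_sq_expectation: "(\<integral>\<omega>. (amp k a \<omega> * amp k b \<omega>)\<^sup>2 \<partial>M) \<le> 1 + \<rho>\<^sup>2 * (\<integral>\<omega>. energy k \<omega> \<partial>M)"
proof -
  have i: "integrable M (\<lambda>\<omega>. 1 + \<rho>\<^sup>2 * energy k \<omega>)" using energy_integrable by simp
  have j: "integrable M (\<lambda>\<omega>. (amp k a \<omega> * amp k b \<omega>)\<^sup>2)"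
    by (rule Bochner_Integration.integrable_bound[OF i])
      (use past_measurable_M[OF amp2_past] amp2_sq_le in \<open>auto intro!: borel_measurable_power order_trans[OF _ abs_ge_self]\<close>)
  then show "sq_integrable M (\<lambda>\<omega>. amp k a \<omega> * amp k b \<omega>)"
    unfolding sq_integrable_def using past_measurable_M[OF amp2_past] by blast
  have "(\<integral>\<omega>. (amp k a \<omega> * amp k b \<omega>)\<^sup>2 \<partial>M) \<le> (\<integral>\<omega>. 1 + \<rho>\<^sup>2 * energy k \<omega> \<partial>M)"
    by (rule integral_mono[OF j i amp2_sq_le])
  then show "(\<integral>\<omega>. (amp k a \<omega> * amp k b \<omega>)\<^sup>2 \<partial>M) \<le> 1 + \<rho>\<^sup>2 * (\<integral>\<omega>. energy k \<omega> \<partial>M)"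
    using energy_integrable by (simp add: prob_space)
qed

lemma \<xi>_sq: "sq_integrable M (\<xi> k i)"
  unfolding \<xi>_def by (intro sq_integrable_sum past_present_mult(1)[OF amp2_past amp2_sq fluct_present fluct_moments(1)])

text \<open>Multiplied by \<open>Z\<close>, an amplitude product is merely integrable, but this
  suffices for the product rule with the independent, centred \<open>fluct\<close>.\<close>

lemma \<xi>_orthogonal:
  assumes Z: "Z \<in> borel_measurable (past k)" "sq_integrable M Z"
  shows "(\<integral>\<omega>. Z \<omega> * \<xi> k i \<omega> \<partial>M) = 0"
proof -
  have tm: "integrable M (\<lambda>\<omega>. Z \<omega> * (amp k a \<omega> * amp k b \<omega> * fluct k i a b \<omega>)) \<and>
      (\<integral>\<omega>. Z \<omega> * (amp k a \<omega> * amp k b \<omega> * fluct k i a b \<omega>) \<partial>M) = 0" for a b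
  proof -
    have "(\<lambda>\<omega>. Z \<omega> * (amp k a \<omega> * amp k b \<omega>)) \<in> borel_measurable (past k)"
      by (intro borel_measurable_times Z amp_past)
    then have iv: "indep_var borel (\<lambda>\<omega>. Z \<omega> * (amp k a \<omega> * amp k b \<omega>)) borel (fluct k i a b)"
      using fluct_present by (rule indep_past_present)
    have "integrable M (\<lambda>\<omega>. Z \<omega> * (amp k a \<omega> * amp k b \<omega>))"
      by (rule sq_integrable_mult[OF Z(2) amp2_sq])
    then show ?thesis
      using indep_var_integrable[OF iv] indep_var_lebesgue_integral[OF iv]
        sq_integrable_integrable[OF fluct_moments(1)[of k i a b]] fluct_moments(2)[of k i a b]
      by (simp add: mult.assoc)
  qed
  show ?thesis
    unfolding \<xi>_def sum_distrib_left using tm by (simp add: Bochner_Integration.integral_sum)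
qed

lemma \<xi>_mean: "(\<integral>\<omega>. \<xi> k i \<omega> \<partial>M) = 0"
  using \<xi>_orthogonal[of "\<lambda>_. 1"] sq_integrable_const[of 1] by simp

lemma drift_past: "drift k i \<in> borel_measurable (past k)"
  using state_past unfolding drift_def by measurable

lemma drift_sq: "sq_integrable M (drift k i)"
  unfolding drift_def
  by (intro sq_integrable_sum sq_integrable_cmult sq_integrable_diff sq_integrable_abs state_sq)

end

lemma \<xi>_adapted:
  assumes "\<And>i. state k i \<in> borel_measurable (past k)" "\<And>i. sq_integrable M (state k i)"
  shows "\<xi> k i \<in> borel_measurable (past (Suc k))"
  unfolding \<xi>_def
  by (intro borel_measurable_sum borel_measurable_times measurable_past_Suc(1)[OF amp_past[OF assms]]
      measurable_past_Suc(2)[OF fluct_present])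

lemma state_adapted: "(\<forall>i. state k i \<in> borel_measurable (past k)) \<and> (\<forall>i. sq_integrable M (state k i))"
proof (induction k)
  case 0
  have "state 0 i = (\<lambda>_. x0 i)" for i by (simp add: fun_eq_iff state_0)
  then show ?case by (simp add: sq_integrable_const)
next
  case (Suc k)
  have eq: "state (Suc k) i = (\<lambda>\<omega>. state k i \<omega> + \<alpha> k * drift k i \<omega> + \<alpha> k * \<xi> k i \<omega>)" for i
    by (simp add: fun_eq_iff state_Suc)
  have 1: "\<And>i. state k i \<in> borel_measurable (past k)" and 2: "\<And>i. sq_integrable M (state k i)"
    using Suc by auto
  show ?case
  proof (intro conjI allI)
    fix i
    show "state (Suc k) i \<in> borel_measurable (past (Suc k))"
      unfolding eq using measurable_past_Suc(1)[OF 1] measurable_past_Suc(1)[OF drift_past[OF 1 2]] \<xi>_adapted[OF 1 2]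
      by (intro borel_measurable_add borel_measurable_times borel_measurable_const) auto
    show "sq_integrable M (state (Suc k) i)"
      unfolding eq by (intro sq_integrable_add sq_integrable_cmult 2 drift_sq[OF 1 2] \<xi>_sq[OF 1 2])
  qed
qed

lemma state_past: "state k i \<in> borel_measurable (past k)" and state_sq: "sq_integrable M (state k i)"
  using state_adapted by blast+

lemmas energy_int = energy_integrable[OF state_past state_sq]
lemmas \<xi>_sq_integrable = \<xi>_sq[OF state_past state_sq]
lemmas \<xi>_orth = \<xi>_orthogonal[OF state_past state_sq]
lemmas \<xi>_mean_zero = \<xi>_mean[OF state_past state_sq]
lemmas drift_sq_integrable = drift_sq[OF state_past state_sq]
lemmas drift_adapted = drift_past[OF state_past state_sq]

section \<open>Boundedness of the expected energy\<close>

lemma energy_nonneg: "0 \<le> energy k \<omega>"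
  unfolding energy_def by (intro sum_nonneg) simp

lemma expected_energy_nonneg: "0 \<le> (\<integral>\<omega>. energy k \<omega> \<partial>M)"
  by (rule Bochner_Integration.integral_nonneg) (rule energy_nonneg)

text \<open>The fourth power of the number of links arises from Cauchy-Schwarz applied to each of
  the two sums in \<xi>, followed by a uniform bound on all summands.\<close>

definition \<xi>_const :: real where
  "\<xi>_const = (real CARD('v option))^4 * (1 + \<rho>\<^sup>2) * fourth_bound"

lemma fourth_bound_nonneg: "0 \<le> fourth_bound"
  unfolding fourth_bound_def by (intro sum_nonneg) simp

lemma \<xi>_const_nonneg: "0 \<le> \<xi>_const"
  unfolding \<xi>_const_def by (intro mult_nonneg_nonneg fourth_bound_nonneg) auto

lemma \<xi>_second_moment: "(\<integral>\<omega>. (\<xi> k i \<omega>)\<^sup>2 \<partial>M) \<le> \<xi>_const * (1 + (\<integral>\<omega>. energy k \<omega> \<partial>M))"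
proof -
  let ?m = "real CARD('v option)" and ?w = "\<integral>\<omega>. energy k \<omega> \<partial>M"
  let ?t = "\<lambda>a b \<omega>. amp k a \<omega> * amp k b \<omega> * fluct k i a b \<omega>"
  note vg = past_present_mult[OF amp2_past[OF state_past state_sq] amp2_sq[OF state_past state_sq] fluct_present fluct_moments(1)]
  have ti: "integrable M (\<lambda>\<omega>. (?t a b \<omega>)\<^sup>2)" for a b
    using vg(1)[of k a b i a b] by (simp only: sq_integrable_def)
  have "(\<xi> k i \<omega>)\<^sup>2 \<le> ?m * (\<Sum>a\<in>UNIV. ?m * (\<Sum>b\<in>UNIV. (?t a b \<omega>)\<^sup>2))" for \<omega>
    unfolding \<xi>_def
    by (rule order_trans[OF sq_sum_le_card_mult_sum_sq])
      (intro mult_left_mono sum_mono sq_sum_le_card_mult_sum_sq; simp)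
  then have "(\<integral>\<omega>. (\<xi> k i \<omega>)\<^sup>2 \<partial>M) \<le> (\<integral>\<omega>. ?m * (\<Sum>a\<in>UNIV. ?m * (\<Sum>b\<in>UNIV. (?t a b \<omega>)\<^sup>2)) \<partial>M)"
    using \<xi>_sq_integrable[of k i] ti
    by (intro integral_mono) (auto simp: sq_integrable_def)
  also have "\<dots> = ?m * (\<Sum>a\<in>UNIV. ?m * (\<Sum>b\<in>UNIV. \<integral>\<omega>. (?t a b \<omega>)\<^sup>2 \<partial>M))"
    using ti by (simp add: Bochner_Integration.integral_sum)
  also have "\<dots> \<le> ?m * (\<Sum>a::'v option\<in>UNIV. ?m * (\<Sum>b::'v option\<in>UNIV. (1 + \<rho>\<^sup>2 * ?w) * fourth_bound))"
  proof (intro mult_left_mono sum_mono)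
    fix a b
    show "(\<integral>\<omega>. (?t a b \<omega>)\<^sup>2 \<partial>M) \<le> (1 + \<rho>\<^sup>2 * ?w) * fourth_bound"
      unfolding vg(2) using expected_energy_nonneg[of k]
      by (intro mult_mono amp2_sq_expectation[OF state_past state_sq] fluct_moments(3)) auto
  qed simp_all
  also have "\<dots> = ?m^4 * fourth_bound * (1 + \<rho>\<^sup>2 * ?w)"
    by (simp add: power4_eq_xxxx)
  also have "\<dots> \<le> ?m^4 * fourth_bound * ((1 + \<rho>\<^sup>2) * (1 + ?w))"
    using expected_energy_nonneg[of k] fourth_bound_nonneg by (intro mult_left_mono) (auto simp: algebra_simps)
  finally show ?thesis by (simp add: \<xi>_const_def mult_ac)
qed

text \<open>Symmetry of the weights lets the outgoing term be re-indexed as an incoming one: the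
  Laplacian part conserves the sum of the states.\<close>

lemma sum_drift: "(\<Sum>i\<in>UNIV. drift k i \<omega>) = (\<Sum>i\<in>UNIV. \<Sum>j\<in>UNIV. A i j * (\<bar>state k j \<omega>\<bar> - state k j \<omega>))"
proof -
  have "(\<Sum>i\<in>UNIV. \<Sum>j\<in>UNIV. A i j * state k i \<omega>) = (\<Sum>i\<in>UNIV. \<Sum>j\<in>UNIV. A i j * state k j \<omega>)"
    by (subst sum.swap) (simp add: A_sym)
  then show ?thesis
    by (simp add: drift_def right_diff_distrib sum_subtractf)
qed

text \<open>Young's inequality does not see the sign: the product of \<open>x i\<close> and the
  absolute value of \<open>x j\<close> is at most the mean of their squares. What remains cancels by
  symmetry of the weights.\<close>

lemma sum_state_drift_nonpos: "(\<Sum>i\<in>UNIV. state k i \<omega> * drift k i \<omega>) \<le> 0"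
proof -
  let ?x = "\<lambda>i. state k i \<omega>"
  have "(\<Sum>i\<in>UNIV. ?x i * drift k i \<omega>) \<le> (\<Sum>i\<in>UNIV. \<Sum>j\<in>UNIV. A i j * ((?x j)\<^sup>2 / 2) - A i j * ((?x i)\<^sup>2 / 2))"
    unfolding drift_def sum_distrib_left
  proof (intro sum_mono)
    fix i j
    have "?x i * \<bar>?x j\<bar> \<le> ((?x i)\<^sup>2 + (?x j)\<^sup>2) / 2"
      using sum_squares_bound[of "?x i" "\<bar>?x j\<bar>"] by simp
    then have "A i j * (?x i * \<bar>?x j\<bar> - (?x i)\<^sup>2) \<le> A i j * ((?x j)\<^sup>2 / 2 - (?x i)\<^sup>2 / 2)"
      by (intro mult_left_mono A_nonneg) (simp add: field_simps)
    then show "?x i * (A i j * (\<bar>?x j\<bar> - ?x i)) \<le> A i j * ((?x j)\<^sup>2 / 2) - A i j * ((?x i)\<^sup>2 / 2)"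
      by (simp add: power2_eq_square algebra_simps)
  qed
  also have "(\<Sum>i\<in>UNIV. \<Sum>j\<in>UNIV. A i j * ((?x j)\<^sup>2 / 2) - A i j * ((?x i)\<^sup>2 / 2)) =
      (\<Sum>i\<in>UNIV. \<Sum>j\<in>UNIV. A i j * ((?x j)\<^sup>2 / 2)) - (\<Sum>i\<in>UNIV. \<Sum>j\<in>UNIV. A i j * ((?x i)\<^sup>2 / 2))"
    by (simp only: sum_subtractf)
  also have "(\<Sum>i\<in>UNIV. \<Sum>j\<in>UNIV. A i j * ((?x i)\<^sup>2 / 2)) = (\<Sum>i\<in>UNIV. \<Sum>j\<in>UNIV. A i j * ((?x j)\<^sup>2 / 2))"
    by (subst sum.swap) (simp add: A_sym)
  finally show ?thesis by simp
qed

text \<open>The second factor collects \<open>2 * (x j)\<^sup>2 + 2 * (x i)\<^sup>2\<close> summed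
  over all \<open>j\<close>: twice the energy, plus at most \<open>2 * CARD('v)\<close> times the
  energy.\<close>

definition drift_const :: real where
  "drift_const = (\<Sum>i\<in>UNIV. \<Sum>j\<in>UNIV. (A i j)\<^sup>2) * (2 * (1 + real CARD('v)))"

lemma drift_const_nonneg: "0 \<le> drift_const"
  unfolding drift_const_def by (intro mult_nonneg_nonneg sum_nonneg) auto

lemma sum_drift_sq_le: "(\<Sum>i\<in>UNIV. (drift k i \<omega>)\<^sup>2) \<le> drift_const * energy k \<omega>"
proof -
  let ?x = "\<lambda>i. state k i \<omega>"
  have le: "(\<Sum>j\<in>UNIV. (\<bar>?x j\<bar> - ?x i)\<^sup>2) \<le> 2 * (1 + real CARD('v)) * energy k \<omega>" for i
  proof -
    have "(\<Sum>j\<in>UNIV. (\<bar>?x j\<bar> - ?x i)\<^sup>2) \<le> (\<Sum>j\<in>UNIV. 2 * (?x j)\<^sup>2 + 2 * (?x i)\<^sup>2)"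
    proof (rule sum_mono)
      show "(\<bar>?x j\<bar> - ?x i)\<^sup>2 \<le> 2 * (?x j)\<^sup>2 + 2 * (?x i)\<^sup>2" for j
        using zero_le_power2[of "\<bar>?x j\<bar> + ?x i"] unfolding power2_sum power2_diff power2_abs by linarith
    qed
    also have "\<dots> = 2 * energy k \<omega> + 2 * real CARD('v) * (?x i)\<^sup>2"
      by (simp add: energy_def sum.distrib sum_distrib_left[symmetric])
    also have "\<dots> \<le> 2 * energy k \<omega> + 2 * real CARD('v) * energy k \<omega>"
      unfolding energy_def by (intro add_left_mono mult_left_mono member_le_sum[where f = "\<lambda>i. (?x i)\<^sup>2"]) auto
    finally show ?thesis by (simp add: algebra_simps)
  qed
  have "(\<Sum>i\<in>UNIV. (drift k i \<omega>)\<^sup>2) \<le> (\<Sum>i\<in>UNIV. (\<Sum>j\<in>UNIV. (A i j)\<^sup>2) * (\<Sum>j\<in>UNIV. (\<bar>?x j\<bar> - ?x i)\<^sup>2))"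
    unfolding drift_def by (intro sum_mono Cauchy_Schwarz_ineq_sum)
  also have "\<dots> \<le> (\<Sum>i\<in>UNIV. (\<Sum>j\<in>UNIV. (A i j)\<^sup>2) * (2 * (1 + real CARD('v)) * energy k \<omega>))"
    by (intro sum_mono mult_left_mono le sum_nonneg) simp
  also have "\<dots> = drift_const * energy k \<omega>"
    by (simp add: drift_const_def sum_distrib_right mult.assoc)
  finally show ?thesis .
qed

text \<open>The predictable part \<open>?d\<close> is orthogonal to the noise, and its first-order
  change of energy is nonpositive. Only terms of order \<open>(\<alpha> k)\<^sup>2\<close> can
  increase the mean.\<close>

lemma expected_energy_step: "(\<integral>\<omega>. energy (Suc k) \<omega> \<partial>M) \<le> (\<integral>\<omega>. energy k \<omega> \<partial>M) +
    (\<alpha> k)\<^sup>2 * (drift_const * (\<integral>\<omega>. energy k \<omega> \<partial>M) + (\<Sum>i\<in>UNIV. \<integral>\<omega>. (\<xi> k i \<omega>)\<^sup>2 \<partial>M))"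
proof -
  let ?d = "\<lambda>i \<omega>. state k i \<omega> + \<alpha> k * drift k i \<omega>"
  have d_sq: "sq_integrable M (?d i)" for i
    by (intro sq_integrable_add sq_integrable_cmult state_sq drift_sq_integrable)
  have "?d i \<in> borel_measurable (past k)" for i
    by (intro borel_measurable_add borel_measurable_times borel_measurable_const state_past drift_adapted)
  then have orth: "(\<integral>\<omega>. ?d i \<omega> * \<xi> k i \<omega> \<partial>M) = 0" for i
    using d_sq by (rule \<xi>_orth)
  have "(\<integral>\<omega>. (state (Suc k) i \<omega>)\<^sup>2 \<partial>M) = (\<integral>\<omega>. (?d i \<omega>)\<^sup>2 \<partial>M) + (\<alpha> k)\<^sup>2 * (\<integral>\<omega>. (\<xi> k i \<omega>)\<^sup>2 \<partial>M)" for i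
  proof -
    have "(\<integral>\<omega>. (state (Suc k) i \<omega>)\<^sup>2 \<partial>M) =
        (\<integral>\<omega>. (?d i \<omega>)\<^sup>2 + 2 * \<alpha> k * (?d i \<omega> * \<xi> k i \<omega>) + (\<alpha> k)\<^sup>2 * (\<xi> k i \<omega>)\<^sup>2 \<partial>M)"
      unfolding state_Suc by (intro Bochner_Integration.integral_cong refl) (simp add: power2_eq_square algebra_simps)
    also have "\<dots> = (\<integral>\<omega>. (?d i \<omega>)\<^sup>2 \<partial>M) + 2 * \<alpha> k * (\<integral>\<omega>. ?d i \<omega> * \<xi> k i \<omega> \<partial>M) + (\<alpha> k)\<^sup>2 * (\<integral>\<omega>. (\<xi> k i \<omega>)\<^sup>2 \<partial>M)"
    proof -
      have "integrable M (\<lambda>\<omega>. (?d i \<omega>)\<^sup>2)" "integrable M (\<lambda>\<omega>. (\<xi> k i \<omega>)\<^sup>2)"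
        "integrable M (\<lambda>\<omega>. ?d i \<omega> * \<xi> k i \<omega>)"
        using d_sq[of i] \<xi>_sq_integrable[of k i] sq_integrable_mult[OF d_sq[of i] \<xi>_sq_integrable[of k i]]
        unfolding sq_integrable_def by blast+
      then show ?thesis
        by (simp only: Bochner_Integration.integral_add Bochner_Integration.integrable_add
          integrable_mult_right integral_mult_right_zero)
    qed
    finally show ?thesis by (simp only: orth mult_zero_right add_0_right)
  qed
  then have "(\<integral>\<omega>. energy (Suc k) \<omega> \<partial>M) = (\<Sum>i\<in>UNIV. (\<integral>\<omega>. (?d i \<omega>)\<^sup>2 \<partial>M) + (\<alpha> k)\<^sup>2 * (\<integral>\<omega>. (\<xi> k i \<omega>)\<^sup>2 \<partial>M))"
    unfolding energy_def using state_sq[of "Suc k"] by (simp add: Bochner_Integration.integral_sum sq_integrable_def)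
  also have "\<dots> = (\<Sum>i\<in>UNIV. \<integral>\<omega>. (?d i \<omega>)\<^sup>2 \<partial>M) + (\<alpha> k)\<^sup>2 * (\<Sum>i\<in>UNIV. \<integral>\<omega>. (\<xi> k i \<omega>)\<^sup>2 \<partial>M)"
    by (simp only: sum.distrib sum_distrib_left)
  finally have EW: "(\<integral>\<omega>. energy (Suc k) \<omega> \<partial>M) =
      (\<Sum>i\<in>UNIV. \<integral>\<omega>. (?d i \<omega>)\<^sup>2 \<partial>M) + (\<alpha> k)\<^sup>2 * (\<Sum>i\<in>UNIV. \<integral>\<omega>. (\<xi> k i \<omega>)\<^sup>2 \<partial>M)" .
  have "(\<Sum>i\<in>UNIV. \<integral>\<omega>. (?d i \<omega>)\<^sup>2 \<partial>M) = (\<integral>\<omega>. (\<Sum>i\<in>UNIV. (?d i \<omega>)\<^sup>2) \<partial>M)"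
    using d_sq by (intro Bochner_Integration.integral_sum[symmetric]) (simp add: sq_integrable_def)
  also have "\<dots> \<le> (\<integral>\<omega>. energy k \<omega> + (\<alpha> k)\<^sup>2 * (drift_const * energy k \<omega>) \<partial>M)"
  proof (rule integral_mono)
    show "integrable M (\<lambda>\<omega>. \<Sum>i\<in>UNIV. (?d i \<omega>)\<^sup>2)"
      using d_sq by (intro Bochner_Integration.integrable_sum) (simp add: sq_integrable_def)
    show "integrable M (\<lambda>\<omega>. energy k \<omega> + (\<alpha> k)\<^sup>2 * (drift_const * energy k \<omega>))" using energy_int by simp
    fix \<omega>
    have "(\<Sum>i\<in>UNIV. (?d i \<omega>)\<^sup>2) = (\<Sum>i\<in>UNIV. (state k i \<omega>)\<^sup>2 + 2 * \<alpha> k * (state k i \<omega> * drift k i \<omega>) + (\<alpha> k)\<^sup>2 * (drift k i \<omega>)\<^sup>2)"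
      by (intro sum.cong refl) (simp add: power2_eq_square algebra_simps)
    also have "\<dots> = energy k \<omega> + 2 * \<alpha> k * (\<Sum>i\<in>UNIV. state k i \<omega> * drift k i \<omega>) + (\<alpha> k)\<^sup>2 * (\<Sum>i\<in>UNIV. (drift k i \<omega>)\<^sup>2)"
      by (simp only: energy_def sum.distrib sum_distrib_left)
    also have "\<dots> \<le> energy k \<omega> + 2 * \<alpha> k * 0 + (\<alpha> k)\<^sup>2 * (drift_const * energy k \<omega>)"
      using \<alpha>_pos[of k] by (intro add_mono mult_left_mono sum_state_drift_nonpos sum_drift_sq_le) auto
    finally show "(\<Sum>i\<in>UNIV. (?d i \<omega>)\<^sup>2) \<le> energy k \<omega> + (\<alpha> k)\<^sup>2 * (drift_const * energy k \<omega>)" by simp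
  qed
  also have "\<dots> = (\<integral>\<omega>. energy k \<omega> \<partial>M) + (\<alpha> k)\<^sup>2 * (drift_const * (\<integral>\<omega>. energy k \<omega> \<partial>M))"
    using energy_int by simp
  finally show ?thesis unfolding EW by (simp add: algebra_simps)
qed

lemma expected_energy_bounded: obtains B where "\<And>k. (\<integral>\<omega>. energy k \<omega> \<partial>M) \<le> B"
proof -
  define K where "K = drift_const + real CARD('v) * \<xi>_const"
  have K: "0 \<le> K" using drift_const_nonneg \<xi>_const_nonneg by (simp add: K_def)
  \<comment> \<open>Adding 1 absorbs the constant part of the noise variance, which makes the
    recursion purely multiplicative.\<close>
  define w where "w k = 1 + (\<integral>\<omega>. energy k \<omega> \<partial>M)" for k
  have "w k \<le> w 0 * exp (\<Sum>k. K * (\<alpha> k)\<^sup>2)" for k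
  proof (rule multiplicative_growth_bounded)
    show "0 \<le> w k" for k using expected_energy_nonneg[of k] by (simp add: w_def)
    show "0 \<le> K * (\<alpha> k)\<^sup>2" for k using K by simp
    show "summable (\<lambda>k. K * (\<alpha> k)\<^sup>2)" by (rule summable_mult[OF \<alpha>_sq])
    fix k
    have "(\<Sum>i\<in>UNIV. \<integral>\<omega>. (\<xi> k i \<omega>)\<^sup>2 \<partial>M) \<le> (\<Sum>i::'v\<in>UNIV. \<xi>_const * w k)"
      unfolding w_def by (intro sum_mono \<xi>_second_moment)
    moreover have "drift_const * (\<integral>\<omega>. energy k \<omega> \<partial>M) \<le> drift_const * w k"
      using drift_const_nonneg by (simp add: w_def mult_left_mono)
    ultimately have "drift_const * (\<integral>\<omega>. energy k \<omega> \<partial>M) + (\<Sum>i\<in>UNIV. \<integral>\<omega>. (\<xi> k i \<omega>)\<^sup>2 \<partial>M) \<le> K * w k"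
      by (simp add: K_def algebra_simps)
    then have "(\<alpha> k)\<^sup>2 * (drift_const * (\<integral>\<omega>. energy k \<omega> \<partial>M) + (\<Sum>i\<in>UNIV. \<integral>\<omega>. (\<xi> k i \<omega>)\<^sup>2 \<partial>M)) \<le> (\<alpha> k)\<^sup>2 * (K * w k)"
      by (rule mult_left_mono) simp
    with expected_energy_step[of k] show "w (Suc k) \<le> (1 + K * (\<alpha> k)\<^sup>2) * w k"
      by (simp add: w_def algebra_simps)
  qed
  moreover have "(\<integral>\<omega>. energy k \<omega> \<partial>M) \<le> w k" for k by (simp add: w_def)
  ultimately show ?thesis
    by (intro that[of "w 0 * exp (\<Sum>k. K * (\<alpha> k)\<^sup>2)"]) (rule order_trans)
qed

section \<open>Almost sure summability of the perturbations\<close>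

text \<open>Twice the weighted negative parts of the neighbouring states: the deviation of the drift
  from the Laplacian one.\<close>

definition excess :: "nat \<Rightarrow> 'v \<Rightarrow> 'm \<Rightarrow> real" where
  "excess k i \<omega> = (\<Sum>j\<in>UNIV. A i j * (\<bar>state k j \<omega>\<bar> - state k j \<omega>))"

lemma excess_nonneg: "0 \<le> excess k i \<omega>"
  unfolding excess_def by (intro sum_nonneg mult_nonneg_nonneg A_nonneg) simp

lemma drift_eq: "drift k i \<omega> = excess k i \<omega> - lap A (\<lambda>i. state k i \<omega>) i"
  unfolding drift_def excess_def lap_def sum_subtractf[symmetric]
  by (intro sum.cong refl) (simp add: algebra_simps)

lemma excess_integrable: "integrable M (excess k i)"
  unfolding excess_def
  by (intro sq_integrable_integrable sq_integrable_sum sq_integrable_cmult sq_integrable_diff sq_integrable_abs state_sq)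

text \<open>In expectation the weighted excess is exactly the increment of the sum of the states.
  The bounded energy keeps that sum bounded above, so the nonnegative increments are
  summable.\<close>

lemma AE_summable_excess: "AE \<omega> in M. \<forall>i. summable (\<lambda>k. \<alpha> k * excess k i \<omega>)"
proof -
  obtain B where B: "\<And>k. (\<integral>\<omega>. energy k \<omega> \<partial>M) \<le> B" using expected_energy_bounded by blast
  define T where "T k \<omega> = \<alpha> k * (\<Sum>i\<in>UNIV. excess k i \<omega>)" for k \<omega>
  have T_nonneg: "0 \<le> T k \<omega>" for k \<omega>
    unfolding T_def using \<alpha>_pos[of k] by (intro mult_nonneg_nonneg sum_nonneg excess_nonneg) simp
  have T_int: "integrable M (T k)" for k
    unfolding T_def using excess_integrable by simp
  define S where "S k \<omega> = (\<Sum>i\<in>UNIV. state k i \<omega>)" for k \<omega>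
  have S_int: "integrable M (S k)" for k
    unfolding S_def using sq_integrable_integrable[OF state_sq] by simp
  have \<xi>_int: "integrable M (\<xi> k i)" for k i
    by (rule sq_integrable_integrable[OF \<xi>_sq_integrable])
  have S_Suc: "S (Suc k) \<omega> = S k \<omega> + T k \<omega> + \<alpha> k * (\<Sum>i\<in>UNIV. \<xi> k i \<omega>)" for k \<omega>
    unfolding S_def T_def excess_def sum_drift[symmetric]
    by (simp only: state_Suc sum.distrib sum_distrib_left)
  have ES: "(\<integral>\<omega>. S (Suc k) \<omega> \<partial>M) = (\<integral>\<omega>. S k \<omega> \<partial>M) + (\<integral>\<omega>. T k \<omega> \<partial>M)" for k
    unfolding S_Suc using S_int[of k] T_int[of k] \<xi>_int[of k]
    by (simp add: Bochner_Integration.integral_sum \<xi>_mean_zero)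
  have sum_T: "(\<Sum>k<m. \<integral>\<omega>. T k \<omega> \<partial>M) = (\<integral>\<omega>. S m \<omega> \<partial>M) - (\<integral>\<omega>. S 0 \<omega> \<partial>M)" for m
    by (induction m) (simp_all add: ES)
  have ES_le: "(\<integral>\<omega>. S m \<omega> \<partial>M) \<le> CARD('v) + B" for m
  proof -
    have "S m \<omega> \<le> CARD('v) + energy m \<omega>" for \<omega>
    proof -
      have "S m \<omega> \<le> (\<Sum>i::'v\<in>UNIV. 1 + (state m i \<omega>)\<^sup>2)"
        unfolding S_def
      proof (rule sum_mono)
        show "state m i \<omega> \<le> 1 + (state m i \<omega>)\<^sup>2" for i
          using zero_le_power2[of "state m i \<omega> - 1 / 2"] by (simp add: power2_eq_square algebra_simps)
      qed
      then show ?thesis by (simp add: sum.distrib energy_def)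
    qed
    then have "(\<integral>\<omega>. S m \<omega> \<partial>M) \<le> (\<integral>\<omega>. CARD('v) + energy m \<omega> \<partial>M)"
      using S_int energy_int by (intro integral_mono) auto
    also have "\<dots> = CARD('v) + (\<integral>\<omega>. energy m \<omega> \<partial>M)"
      using energy_int by (simp add: prob_space)
    finally show ?thesis using B[of m] by simp
  qed
  have "summable (\<lambda>k. \<integral>\<omega>. T k \<omega> \<partial>M)"
  proof (rule summableI_nonneg_bounded)
    show "0 \<le> (\<integral>\<omega>. T k \<omega> \<partial>M)" for k
      by (rule Bochner_Integration.integral_nonneg) (rule T_nonneg)
    show "(\<Sum>k<m. \<integral>\<omega>. T k \<omega> \<partial>M) \<le> CARD('v) + B - (\<integral>\<omega>. S 0 \<omega> \<partial>M)" for m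
      using ES_le[of m] by (simp add: sum_T)
  qed
  then have "AE \<omega> in M. summable (\<lambda>k. T k \<omega>)"
    by (intro AE_summable_of_summable_integral T_int T_nonneg)
  then show ?thesis
  proof eventually_elim
    case (elim \<omega>)
    show ?case
    proof
      fix i
      have "\<alpha> k * excess k i \<omega> \<le> T k \<omega>" for k
        unfolding T_def using \<alpha>_pos[of k] excess_nonneg
        by (intro mult_left_mono member_le_sum[where f = "\<lambda>i. excess k i \<omega>"]) auto
      then show "summable (\<lambda>k. \<alpha> k * excess k i \<omega>)"
        using \<alpha>_pos excess_nonneg[of _ i \<omega>]
        by (intro summable_comparison_test'[OF elim, of 0]) (simp add: abs_mult less_imp_le)
    qed
  qed
qed

text \<open>Bounded mean energy bounds the noise variances uniformly, so square-summable step sizes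
  give a convergent variance series.\<close>

lemma AE_summable_\<xi>: "AE \<omega> in M. summable (\<lambda>k. \<alpha> k * \<xi> k i \<omega>)"
proof -
  interpret L2_martingale_differences M past "\<lambda>k \<omega>. \<alpha> k * \<xi> k i \<omega>"
  proof
    show "subalgebra M (past k)" for k by (rule subalgebra_past)
    show "sets (past k) \<subseteq> sets (past l)" if "k \<le> l" for k l by (rule past_mono[OF that])
    show "(\<lambda>\<omega>. \<alpha> k * \<xi> k i \<omega>) \<in> borel_measurable (past (Suc k))" for k
      by (intro borel_measurable_times borel_measurable_const \<xi>_adapted[OF state_past state_sq])
    show "integrable M (\<lambda>\<omega>. (\<alpha> k * \<xi> k i \<omega>)\<^sup>2)" for k
      using sq_integrable_cmult[OF \<xi>_sq_integrable, of "\<alpha> k" k i] by (simp only: sq_integrable_def)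
    show "(\<integral>\<omega>. Z \<omega> * (\<alpha> k * \<xi> k i \<omega>) \<partial>M) = 0"
      if "Z \<in> borel_measurable (past k)" "integrable M (\<lambda>\<omega>. (Z \<omega>)\<^sup>2)" for k Z
    proof -
      have "(\<integral>\<omega>. Z \<omega> * \<xi> k i \<omega> \<partial>M) = 0"
        using that past_measurable_M by (intro \<xi>_orth) (auto simp: sq_integrable_def)
      then show ?thesis
        by (simp only: mult.left_commute[of _ "\<alpha> k"] integral_mult_right_zero mult_zero_right)
    qed
  qed
  obtain B where B: "\<And>k. (\<integral>\<omega>. energy k \<omega> \<partial>M) \<le> B" using expected_energy_bounded by blast
  show ?thesis
  proof (rule AE_summable, rule summable_comparison_test'[where N = 0])
    show "summable (\<lambda>k. \<xi>_const * (1 + B) * (\<alpha> k)\<^sup>2)" by (rule summable_mult[OF \<alpha>_sq])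
    fix k
    have "(\<integral>\<omega>. (\<alpha> k * \<xi> k i \<omega>)\<^sup>2 \<partial>M) = (\<alpha> k)\<^sup>2 * (\<integral>\<omega>. (\<xi> k i \<omega>)\<^sup>2 \<partial>M)"
      by (simp add: power_mult_distrib)
    also have "\<dots> \<le> (\<alpha> k)\<^sup>2 * (\<xi>_const * (1 + B))"
      using B[of k] \<xi>_const_nonneg
      by (intro mult_left_mono order_trans[OF \<xi>_second_moment] mult_left_mono) auto
    finally show "norm (\<integral>\<omega>. (\<alpha> k * \<xi> k i \<omega>)\<^sup>2 \<partial>M) \<le> \<xi>_const * (1 + B) * (\<alpha> k)\<^sup>2"
      by (simp add: mult_ac)
  qed
qed

lemma AE_consensus: "AE \<omega> in M. \<exists>c. \<forall>i. (\<lambda>k. state k i \<omega>) \<longlonglongrightarrow> c"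
proof -
  have "AE \<omega> in M. \<forall>i. summable (\<lambda>k. \<alpha> k * \<xi> k i \<omega>)"
    by (simp add: AE_all_countable AE_summable_\<xi>)
  with AE_summable_excess show ?thesis
  proof eventually_elim
    case (elim \<omega>)
    have "\<alpha> \<longlonglongrightarrow> 0"
      using summable_LIMSEQ_zero[OF \<alpha>_sq] by (simp only: power_tendsto_0_iff zero_less_numeral)
    then show ?case
    proof (intro perturbed_laplacian_iteration_tendsto[where E = E and a = \<alpha>
          and w = "\<lambda>k i. \<alpha> k * excess k i \<omega> + \<alpha> k * \<xi> k i \<omega>"])
      show "summable (\<lambda>k. \<alpha> k * excess k i \<omega> + \<alpha> k * \<xi> k i \<omega>)" for i
        using elim by (intro summable_add) auto
      show "state (Suc k) i \<omega> = state k i \<omega> - \<alpha> k * lap A (\<lambda>i. state k i \<omega>) i +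
          (\<alpha> k * excess k i \<omega> + \<alpha> k * \<xi> k i \<omega>)" for k i
        by (simp add: state_Suc drift_eq algebra_simps)
    qed (use A_nonneg A_sym A_pos E_conn \<alpha>_pos \<alpha>_div in blast)+
  qed
qed

lemma almost_sure_consensus:
  "\<exists>xs. xs \<in> borel_measurable M \<and> (\<forall>i. AE \<omega> in M. (\<lambda>k. state k i \<omega>) \<longlonglongrightarrow> xs \<omega>)"
proof (intro exI conjI allI)
  \<comment> \<open>The agent is arbitrary, since almost surely all limits agree. The total function
    \<open>lim\<close> gives a variable that is measurable also across the null set without
    convergence.\<close>
  let ?xs = "\<lambda>\<omega>. lim (\<lambda>k. state k undefined \<omega>)"
  have [measurable]: "state k i \<in> borel_measurable M" for k i
    by (rule past_measurable_M[OF state_past])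
  show "?xs \<in> borel_measurable M" by measurable
  fix i
  show "AE \<omega> in M. (\<lambda>k. state k i \<omega>) \<longlonglongrightarrow> ?xs \<omega>"
    using AE_consensus
  proof eventually_elim
    case (elim \<omega>)
    then obtain c where c: "\<And>i. (\<lambda>k. state k i \<omega>) \<longlonglongrightarrow> c" by blast
    show ?case unfolding limI[OF c] by (rule c)
  qed
qed

end

theorem theorem3:
  fixes M :: "'m measure"
    and E :: "'v::finite \<Rightarrow> 'v \<Rightarrow> bool"
    and x0 :: "'v \<Rightarrow> real" and xmax :: real
    and \<rho> :: real and u :: complex
    and p :: "'v \<Rightarrow> real" and \<Lambda> :: "'v \<Rightarrow> 'v \<Rightarrow> real" and \<sigma> :: "'v \<Rightarrow> real"
    and \<alpha> :: "nat \<Rightarrow> real"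
    and \<gamma> :: "'v \<Rightarrow> nat \<Rightarrow> 'm \<Rightarrow> bool"
    and h :: "'v \<Rightarrow> 'v \<Rightarrow> nat \<Rightarrow> 'm \<Rightarrow> complex"
    and n :: "'v \<Rightarrow> nat \<Rightarrow> 'm \<Rightarrow> complex"
  assumes M: "prob_space M"
    and E_sym: "\<And>i j. E i j \<longleftrightarrow> E j i"
    and E_irrefl: "\<And>i. \<not> E i i"
    and E_conn: "\<And>i j. E\<^sup>*\<^sup>* i j"
    and x0: "\<And>i. 0 \<le> x0 i \<and> x0 i \<le> xmax"
    and \<rho>: "\<rho> > 0"
    and u: "cmod u = 1"
    and p: "\<And>i. 0 < p i \<and> p i < 1"
    and \<Lambda>_sym: "\<And>i j. \<Lambda> i j = \<Lambda> j i"
    and \<Lambda>_pos: "\<And>i j. \<Lambda> i j > 0"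
    and \<sigma>_pos: "\<And>i. \<sigma> i > 0"
    and \<gamma>_meas: "\<And>i k. \<gamma> i k \<in> measurable M (count_space UNIV)"
    and \<gamma>_dist: "\<And>i k. measure M {\<omega> \<in> space M. \<gamma> i k \<omega>} = p i"
    and h_dist: "\<And>i j k. distributed M lborel (h i j k) (\<lambda>z. ennreal (cn_density (\<Lambda> i j) z))"
    and n_dist: "\<And>i k. distributed M lborel (n i k) (\<lambda>z. ennreal (cn_density ((\<sigma> i)\<^sup>2) z))"
    and indep: "prob_space.indep_vars M (\<lambda>_. borel) (oac_family \<gamma> h n) UNIV"
    and \<alpha>_pos: "\<And>k. \<alpha> k > 0"
    and \<alpha>_div: "\<not> summable \<alpha>"
    and \<alpha>_sq: "summable (\<lambda>k. (\<alpha> k)\<^sup>2)"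
    and \<alpha>_small: "\<And>i k. 1 - \<alpha> k * (\<Sum>j\<in>UNIV. abar \<rho> E p \<Lambda> i j) > 0"
  shows "\<exists>xs :: 'm \<Rightarrow> real. xs \<in> borel_measurable M \<and>
           (\<forall>i. AE \<omega> in M.
              (\<lambda>k. oac_state \<rho> u E p \<Lambda> \<sigma> \<alpha> x0 \<gamma> h n k i \<omega>) \<longlonglongrightarrow> xs \<omega>)"
proof -
  interpret over_the_air_consensus M E x0 \<rho> u p \<Lambda> \<sigma> \<alpha> \<gamma> h n
    by (rule over_the_air_consensus.intro[OF M], rule over_the_air_consensus_axioms.intro) (fact assms)+
  show ?thesis using almost_sure_consensus unfolding state_def .
qed

end
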